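(* Let $(M,\Gamma,Z)$ be the tuple associated to the resolved conifold defined in the context. Then $(M,\Gamma,Z)$ is a central charge ASK (affine special Kähler) geometry. If $g_{sK}:=\omega(-,J-)$ denotes the ASK metric, where $\omega=\frac14\langle dZ\wedge d\overline Z\rangle$ and $J$ is the complex structure of $M$, then $g_{sK}$ is a positive definite metric on $M_+$ and a negative definite metric on $M_-$.
   Context: **The tuple.** $M:=\{t\in\mathbb{C}^\times : |\mathrm{Re}(t)|<\tfrac12,\ 2\mathrm{Re}(e^{2\pi i t})\neq1\}$, a one-dimensional complex manifold. The condition $2\mathrm{Re}(e^{2\pi it})\ne1$ divides $M$ into two components $M=M_+\cup M_-$: $M_+=\{2\mathrm{Re}(e^{2\pi it})>1\}$, which contains all $t$ sufficiently close to $0$ and the ray $i\mathbb{R}_{<0}$, and $M_-=\{2\mathrm{Re}(e^{2\pi it})<1\}$, which contains $i\mathbb{R}_{>a}$ for $a>0$ sufficiently big. Let $M_0=M\setminus i\mathbb{R}_{\le0}$. $\Gamma\to M$ is the local system of rank 3 lattices trivialized over $M_0$ by $(\delta,\beta,\beta^\vee)$, where $\delta,\beta$ are global sections and the flat continuation of $\beta^\vee$ counterclockwise across $i\mathbb{R}_{\le0}$ is $\beta^\vee+\beta$. It carries the skew pairing with $\langle\delta,\beta\rangle=\langle\delta,\beta^\vee\rangle=0$, $\langle\beta^\vee,\beta\rangle=1$; $\Gamma_f=\mathbb{Z}\delta$, $\Gamma_g=\Gamma/\Gamma_f$. $Z$ is the holomorphic section of $\Gamma^*\otimes\mathbb{C}\to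 M$ given over $M_0$, with principal branches, by $$Z_\delta=1,\quad Z_\beta=t,\quad Z_{\beta^\vee}=-\tfrac{1}{(2\pi i)^2}\Big(\tfrac12(\log e^{2\pi it})^2+\mathrm{Li}_2(e^{2\pi it})\Big)$$ (it extends to all of $M$ compatibly with the jump of $\beta^\vee$). **Central charge ASK geometry.** In general consider $(M,\Gamma,Z)$ with $M$ a complex manifold of dimension $r$; $\Gamma\to M$ a local system of lattices, an extension $0\to\Gamma_f\to\Gamma\to\Gamma_g\to0$ with $\Gamma_f$ a trivial local system and $\Gamma_g$ of rank $2r$, with a skew, fiberwise, parallel pairing $\langle-,-\rangle:\Gamma\times\Gamma\to\mathbb{Z}$ vanishing when one argument is in $\Gamma_f$, and such that the induced pairing on $\Gamma_g$ locally admits Darboux frames $(\widetilde\gamma_i,\gamma^i)$, $\langle\widetilde\gamma_i,\gamma^j\rangle=\delta_i^j$ (other pairings zero); and $Z$ a holomorphic section of $\Gamma^*\otimes\mathbb{C}$, $Z_\gamma:=Z(\gamma)$, with $Z_{\gamma_f}$ constant for sections $\gamma_f$ of $\Gamma_f$. Then $dZ$ is a one-form with values in $\Gamma_g^*\otimes\mathbb{C}$, and the pairing is transported to $\Gamma_g^*\otimes\mathbb{C}$ ($\mathbb{C}$-bilinearly) via $\gamma\mapsto\langle\gamma,-\rangle$, so that $\langle dX\wedge dY\rangle=dX_{\widetilde\gamma_i}\wedge dY_{\gamma^i}-dX_{\gamma^i}\wedge dY_{\widetilde\gamma_i}$. $(M,\Gamma,Z)$ is a *central charge ASK geometry* if: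 (i) for local sections $(\widetilde\gamma_i,\gamma^i)$ of $\Gamma$ projecting to a Darboux frame of $\Gamma_g$, the one-forms $dZ_{\gamma^i}$ (or $dZ_{\widetilde\gamma_i}$) give a local frame of $T^*M$; (ii) $\langle dZ\wedge dZ\rangle=0$; (iii) the two-form $\omega:=\frac14\langle dZ\wedge d\overline Z\rangle$ is non-degenerate. *)

theory Defs
  imports "HOL-Complex_Analysis.Complex_Analysis"
begin

section \<open>Domains with a complex structure\<close>

text \<open>
  The complex manifolds considered here are the open subsets \<open>M\<close> of a real Euclidean space carrying
  a constant complex structure \<open>J\<close>; all tangent spaces are identified with the ambient space, and
  the complex dimension is half of the real one. For the ambient space \<^typ>\<open>complex\<close> the complex
  structure is multiplication by \<open>\<i>\<close>.
\<close>

definition complex_structure :: "('v::euclidean_space \<Rightarrow> 'v) \<Rightarrow> bool" where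
  "complex_structure J \<longleftrightarrow> linear J \<and> (\<forall>v. J (J v) = - v)"

definition cdim :: "'v::euclidean_space itself \<Rightarrow> nat" where
  "cdim _ = DIM('v) div 2"

definition J_holomorphic_on ::
    "('v::euclidean_space \<Rightarrow> 'v) \<Rightarrow> ('v \<Rightarrow> complex) \<Rightarrow> 'v set \<Rightarrow> bool" where
  "J_holomorphic_on J f U \<longleftrightarrow>
     (\<forall>x\<in>U. \<exists>D. (f has_derivative D) (at x) \<and> (\<forall>v. D (J v) = \<i> * D v))"

definition cotangent_basis ::
    "('v::euclidean_space \<Rightarrow> 'v) \<Rightarrow> nat \<Rightarrow> (nat \<Rightarrow> 'v \<Rightarrow> complex) \<Rightarrow> bool" where
  "cotangent_basis J r \<theta> \<longleftrightarrow>
     (\<forall>i<r. linear (\<theta> i) \<and> (\<forall>v. \<theta> i (J v) = \<i> * \<theta> i v)) \<and>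
     (\<forall>l. linear l \<and> (\<forall>v. l (J v) = \<i> * l v) \<longrightarrow>
        (\<exists>!c. c \<in> {..<r} \<rightarrow>\<^sub>E UNIV \<and> (\<forall>v. l v = (\<Sum>i<r. c i * \<theta> i v))))"

text \<open>\<open>Ck_on k U f\<close>: \<open>f\<close> is \<open>k\<close> times differentiable on the open set \<open>U\<close> with continuous
  \<open>k\<close>-th derivatives.\<close>

primrec Ck_on :: "nat \<Rightarrow> 'v::euclidean_space set \<Rightarrow> ('v \<Rightarrow> complex) \<Rightarrow> bool" where
  "Ck_on 0 U f \<longleftrightarrow> continuous_on U f"
| "Ck_on (Suc k) U f \<longleftrightarrow>
     (\<forall>x\<in>U. f differentiable (at x)) \<and>
     (\<forall>v. Ck_on k U (\<lambda>x. frechet_derivative f (at x) v))"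

definition positive_definite_metric_on ::
    "'v::euclidean_space set \<Rightarrow> ('v \<Rightarrow> 'v \<Rightarrow> 'v \<Rightarrow> complex) \<Rightarrow> bool" where
  "positive_definite_metric_on U g \<longleftrightarrow>
     (\<forall>u v k. Ck_on k U (\<lambda>x. g x u v)) \<and>
     (\<forall>x\<in>U. bilinear (g x) \<and>
        (\<forall>u v. g x u v \<in> \<real> \<and> g x u v = g x v u) \<and>
        (\<forall>u. u \<noteq> 0 \<longrightarrow> 0 < Re (g x u u)))"

definition negative_definite_metric_on ::
    "'v::euclidean_space set \<Rightarrow> ('v \<Rightarrow> 'v \<Rightarrow> 'v \<Rightarrow> complex) \<Rightarrow> bool" where
  "negative_definite_metric_on U g \<longleftrightarrow> positive_definite_metric_on U (\<lambda>x u v. - g x u v)"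


section \<open>Local systems of lattices\<close>

definition locally_constant_on :: "'a::topological_space set \<Rightarrow> ('a \<Rightarrow> 'b) \<Rightarrow> bool" where
  "locally_constant_on U f \<longleftrightarrow> (\<forall>x\<in>U. \<exists>V. open V \<and> x \<in> V \<and> f constant_on (U \<inter> V))"

text \<open>
  A local system of rank \<open>n\<close> lattices on \<open>M\<close> is given by a copy of \<open>\<int>\<^sup>n\<close> over every point, together
  with local trivializations \<open>(U, \<phi>)\<close> whose changes of trivialization are locally constant. The
  identification of the fibre over a point with \<open>\<int>\<^sup>n\<close> is not assumed to vary
  compatibly from point to point: only the trivializations know which sections are flat.
\<close>

type_synonym ('v, 'n) trivialization = "'v set \<times> ('v \<Rightarrow> int ^ 'n \<Rightarrow> int ^ 'n)"

definition local_system ::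
    "'v::topological_space set \<Rightarrow> ('v, 'n::finite) trivialization set \<Rightarrow> bool" where
  "local_system M \<A> \<longleftrightarrow>
     (\<forall>(U, \<phi>)\<in>\<A>. open U \<and> U \<subseteq> M \<and> (\<forall>x\<in>U. bij (\<phi> x) \<and> Modules.additive (\<phi> x))) \<and>
     M = (\<Union>(U, \<phi>)\<in>\<A>. U) \<and>
     (\<forall>(U, \<phi>)\<in>\<A>. \<forall>(V, \<psi>)\<in>\<A>. locally_constant_on (U \<inter> V) (\<lambda>x. \<phi> x \<circ> inv (\<psi> x)))"

text \<open>Sections of the local system over \<open>U\<close>, i.e. flat sections of the underlying bundle.\<close>

definition flat_section ::
    "'v::topological_space set \<Rightarrow> ('v, 'n::finite) trivialization set \<Rightarrow> 'v set
      \<Rightarrow> ('v \<Rightarrow> int ^ 'n) \<Rightarrow> bool" where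
  "flat_section M \<A> U s \<longleftrightarrow> open U \<and> U \<subseteq> M \<and>
     (\<forall>(V, \<phi>)\<in>\<A>. locally_constant_on (U \<inter> V) (\<lambda>x. \<phi> x (s x)))"

definition flat_extension ::
    "'v::topological_space set \<Rightarrow> ('v, 'n::finite) trivialization set \<Rightarrow> 'v \<Rightarrow> int ^ 'n
      \<Rightarrow> ('v \<Rightarrow> int ^ 'n)" where
  "flat_extension M \<A> x \<gamma> = (SOME s. s x = \<gamma> \<and> (\<exists>U. x \<in> U \<and> flat_section M \<A> U s))"

text \<open>The classes modulo \<open>N\<close> of the family \<open>e\<close> form a \<open>\<int>\<close>-basis of \<open>L / N\<close>.\<close>

definition quotient_basis ::
    "(int ^ 'n) set \<Rightarrow> (int ^ 'n) set \<Rightarrow> 'i set \<Rightarrow> ('i \<Rightarrow> int ^ 'n) \<Rightarrow> bool" where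
  "quotient_basis L N I e \<longleftrightarrow> (\<forall>i\<in>I. e i \<in> L) \<and>
     (\<forall>\<gamma>\<in>L. \<exists>!c. c \<in> I \<rightarrow>\<^sub>E UNIV \<and> \<gamma> - (\<Sum>i\<in>I. c i *s e i) \<in> N)"


section \<open>Central charge ASK geometries\<close>

text \<open>
  The fibre of the local system \<open>\<Gamma>\<close> over every point is \<open>\<int>\<^sup>n\<close>; \<open>flavour x\<close> is the fibre of
  \<open>\<Gamma>\<^sub>f\<close> over \<open>x\<close>, and \<open>\<Gamma>\<^sub>g\<close> is the quotient. Vectors in a fibre of \<open>\<Gamma>\<^sub>g\<close> are handled through
  their representatives in \<open>\<Gamma>\<close>, and covectors on it as covectors on \<open>\<Gamma>\<close> vanishing on \<open>\<Gamma>\<^sub>f\<close>.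
\<close>

record ('v, 'n) charge_tuple =
  base :: "'v set"
  trivs :: "('v, 'n) trivialization set"
  flavour :: "'v \<Rightarrow> (int ^ 'n) set"
  pairing :: "'v \<Rightarrow> int ^ 'n \<Rightarrow> int ^ 'n \<Rightarrow> int"
  charge :: "'v \<Rightarrow> int ^ 'n \<Rightarrow> complex"

abbreviation flat_on ::
    "('v::euclidean_space, 'n::finite) charge_tuple \<Rightarrow> 'v set \<Rightarrow> ('v \<Rightarrow> int ^ 'n) \<Rightarrow> bool" where
  "flat_on G \<equiv> flat_section (base G) (trivs G)"

definition darboux_frame ::
    "('v::euclidean_space, 'n::finite) charge_tuple \<Rightarrow> 'v set
      \<Rightarrow> (nat \<Rightarrow> 'v \<Rightarrow> int ^ 'n) \<Rightarrow> (nat \<Rightarrow> 'v \<Rightarrow> int ^ 'n) \<Rightarrow> bool" where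
  "darboux_frame G U gt g \<longleftrightarrow>
     (\<forall>i<cdim TYPE('v). flat_on G U (gt i) \<and> flat_on G U (g i)) \<and>
     (\<forall>x\<in>U.
        quotient_basis UNIV (flavour G x) ({..<cdim TYPE('v)} <+> {..<cdim TYPE('v)})
          (case_sum (\<lambda>i. gt i x) (\<lambda>i. g i x)) \<and>
        (\<forall>i<cdim TYPE('v). \<forall>j<cdim TYPE('v).
           pairing G x (gt i x) (g j x) = (if i = j then 1 else 0) \<and>
           pairing G x (gt i x) (gt j x) = 0 \<and>
           pairing G x (g i x) (g j x) = 0))"

text \<open>
  In the fourth conjunct, the flat sections \<open>f 0, \<dots>, f (k - 1)\<close> trivialize \<open>\<Gamma>\<^sub>f\<close> globally. The charge
  is required to be constant along them on all of the base, not only on its connected components;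
  in particular it is locally constant along every local flat section of \<open>\<Gamma>\<^sub>f\<close>. The existence of
  local Darboux frames, which are bases of the fibres of \<open>\<Gamma>\<^sub>g\<close>, also says that \<open>\<Gamma>\<^sub>g\<close> is a local
  system of lattices of rank twice the complex dimension.
\<close>

definition central_charge_setting ::
    "('v::euclidean_space \<Rightarrow> 'v) \<Rightarrow> ('v, 'n::finite) charge_tuple \<Rightarrow> bool" where
  "central_charge_setting J G \<longleftrightarrow>
     complex_structure J \<and> open (base G) \<and>
     local_system (base G) (trivs G) \<and>
     (\<exists>k f. (\<forall>j<(k::nat). flat_on G (base G) (f j) \<and>
               (\<lambda>x. charge G x (f j x)) constant_on (base G)) \<and>
            (\<forall>x\<in>base G. quotient_basis (flavour G x) {0} {..<k} (\<lambda>j. f j x))) \<and>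
     (\<forall>x\<in>base G. 0 \<in> flavour G x \<and>
        (\<forall>\<gamma>\<in>flavour G x. \<forall>\<gamma>'\<in>flavour G x. \<gamma> - \<gamma>' \<in> flavour G x)) \<and>
     (\<forall>x\<in>base G. \<forall>\<gamma>.
        Modules.additive (pairing G x \<gamma>) \<and>
        (\<forall>\<gamma>'. pairing G x \<gamma>' \<gamma> = - pairing G x \<gamma> \<gamma>') \<and>
        (\<forall>\<gamma>'\<in>flavour G x. pairing G x \<gamma> \<gamma>' = 0)) \<and>
     (\<forall>U s s'. flat_on G U s \<and> flat_on G U s' \<longrightarrow>
        locally_constant_on U (\<lambda>x. pairing G x (s x) (s' x))) \<and>
     (\<forall>x\<in>base G. \<exists>U gt g. x \<in> U \<and> U \<subseteq> base G \<and> open U \<and> darboux_frame G U gt g) \<and>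
     (\<forall>x\<in>base G. Modules.additive (charge G x)) \<and>
     (\<forall>U s. flat_on G U s \<longrightarrow> J_holomorphic_on J (\<lambda>x. charge G x (s x)) U)"

text \<open>For a section \<open>X\<close> of \<open>\<Gamma>\<^sup>* \<otimes> \<complex>\<close>, the value \<open>(dX)\<^sub>\<gamma>(v)\<close> at the point \<open>x\<close>.\<close>

definition dcharge ::
    "('v::euclidean_space, 'n::finite) charge_tuple \<Rightarrow> ('v \<Rightarrow> int ^ 'n \<Rightarrow> complex)
      \<Rightarrow> 'v \<Rightarrow> 'v \<Rightarrow> int ^ 'n \<Rightarrow> complex" where
  "dcharge G X x v \<gamma> =
     frechet_derivative (\<lambda>y. X y (flat_extension (base G) (trivs G) x \<gamma> y)) (at x) v"

text \<open>
  The \<open>\<complex>\<close>-bilinear extension of a pairing on \<open>\<int>\<^sup>n\<close>, and its transport to covectors along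
  \<open>a \<mapsto> \<langle>a, -\<rangle>\<close>. The result does not depend on the choice of \<open>a\<close> and \<open>b\<close>, since \<open>\<langle>a, b\<rangle>\<close> is
  determined by \<open>\<langle>a, -\<rangle>\<close> alone and, by skewness, by \<open>\<langle>b, -\<rangle>\<close> alone.
\<close>

definition complexified :: "(int ^ 'n \<Rightarrow> int ^ 'n \<Rightarrow> int) \<Rightarrow> complex ^ 'n \<Rightarrow> complex ^ 'n \<Rightarrow> complex"
  where
  "complexified B a b =
     (\<Sum>i\<in>UNIV. \<Sum>j\<in>UNIV. a $ i * b $ j * of_int (B (axis i 1) (axis j 1)))"

definition dual_pairing ::
    "(int ^ 'n \<Rightarrow> int ^ 'n \<Rightarrow> int) \<Rightarrow> (int ^ 'n \<Rightarrow> complex) \<Rightarrow> (int ^ 'n \<Rightarrow> complex) \<Rightarrow> complex" where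
  "dual_pairing B \<xi> \<eta> = (THE c. \<exists>a b.
     (\<forall>\<gamma>. \<xi> \<gamma> = complexified B a (\<chi> i. of_int (\<gamma> $ i))) \<and>
     (\<forall>\<gamma>. \<eta> \<gamma> = complexified B b (\<chi> i. of_int (\<gamma> $ i))) \<and>
     c = complexified B a b)"

lemma additive_sum_scale:
  fixes f :: "int ^ 'n \<Rightarrow> 'a::comm_ring_1"
  assumes "Modules.additive f" "finite I"
  shows "f (\<Sum>i\<in>I. c i *s e i) = (\<Sum>i\<in>I. of_int (c i) * f (e i))"
proof -
  interpret Modules.additive f by fact
  have "f (k *s v) = of_int k * f v" for k :: int and v
  proof (induction k rule: int_induct[where k = 0])
    case base show ?case by (simp add: zero)
  next
    case (step1 i) then show ?case by (simp add: vector_sadd_rdistrib add algebra_simps)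
  next
    case (step2 i)
    have "(i - 1) *s v = i *s v - v" by (simp add: vec_eq_iff algebra_simps)
    then show ?case using step2 by (simp add: diff algebra_simps)
  qed
  then show ?thesis by (simp add: sum)
qed

lemma dual_pairing_unique:
  fixes B :: "int ^ 'n \<Rightarrow> int ^ 'n \<Rightarrow> int"
  assumes skew: "\<And>\<gamma> \<gamma>'. B \<gamma>' \<gamma> = - B \<gamma> \<gamma>'"
    and a: "\<And>\<gamma>. \<xi> \<gamma> = complexified B a (\<chi> i. of_int (\<gamma> $ i))"
    and b: "\<And>\<gamma>. \<eta> \<gamma> = complexified B b (\<chi> i. of_int (\<gamma> $ i))"
  shows "dual_pairing B \<xi> \<eta> = complexified B a b"
proof -
  have ax: "(\<chi> i. of_int (axis j 1 $ i)) = (axis j 1 :: complex ^ 'n)" for j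
    by (simp add: axis_def vec_eq_iff)
  have ev: "complexified B x (axis j 1) = (\<Sum>i\<in>UNIV. x $ i * of_int (B (axis i 1) (axis j 1)))"
    for x j
    by (simp add: complexified_def axis_def if_distrib[of "(*) _"] if_distrib[of "\<lambda>y. y * _"]
        cong: if_cong)
  have ext: "complexified B x y = (\<Sum>j\<in>UNIV. y $ j * complexified B x (axis j 1))" for x y
    unfolding ev unfolding complexified_def
    by (subst sum.swap) (simp add: sum_distrib_left algebra_simps)
  have sk: "complexified B x y = - complexified B y x" for x y
  proof -
    have "complexified B x y =
        (\<Sum>j\<in>UNIV. \<Sum>i\<in>UNIV. x $ i * y $ j * of_int (B (axis i 1) (axis j 1)))"
      unfolding complexified_def by (rule sum.swap)
    also have "\<dots> = (\<Sum>j\<in>UNIV. \<Sum>i\<in>UNIV. - (y $ j * x $ i * of_int (B (axis j 1) (axis i 1))))"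
      by (intro sum.cong refl, subst skew) (simp add: algebra_simps)
    finally show ?thesis by (simp add: complexified_def sum_negf)
  qed
  show ?thesis unfolding dual_pairing_def
  proof (rule the_equality)
    show "\<exists>a' b'. (\<forall>\<gamma>. \<xi> \<gamma> = complexified B a' (\<chi> i. of_int (\<gamma> $ i))) \<and>
      (\<forall>\<gamma>. \<eta> \<gamma> = complexified B b' (\<chi> i. of_int (\<gamma> $ i))) \<and>
      complexified B a b = complexified B a' b'"
      using a b by blast
  next
    fix c assume "\<exists>a b. (\<forall>\<gamma>. \<xi> \<gamma> = complexified B a (\<chi> i. of_int (\<gamma> $ i))) \<and>
      (\<forall>\<gamma>. \<eta> \<gamma> = complexified B b (\<chi> i. of_int (\<gamma> $ i))) \<and> c = complexified B a b"
    then obtain a' b' where a': "\<And>\<gamma>. \<xi> \<gamma> = complexified B a' (\<chi> i. of_int (\<gamma> $ i))"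
      and b': "\<And>\<gamma>. \<eta> \<gamma> = complexified B b' (\<chi> i. of_int (\<gamma> $ i))"
      and c: "c = complexified B a' b'" by blast
    have 1: "complexified B a (axis j 1) = complexified B a' (axis j 1)" for j
      using a[of "axis j 1"] a'[of "axis j 1"] by (simp add: ax)
    have 2: "complexified B b (axis j 1) = complexified B b' (axis j 1)" for j
      using b[of "axis j 1"] b'[of "axis j 1"] by (simp add: ax)
    have "complexified B a b = complexified B a' b" unfolding ext[of a b] ext[of a' b] 1 ..
    also have "\<dots> = - complexified B b a'" by (rule sk)
    also have "\<dots> = - complexified B b' a'" unfolding ext[of b a'] ext[of b' a'] 2 ..
    also have "\<dots> = complexified B a' b'" by (rule sk[symmetric])
    finally show "c = complexified B a b" using c by simp
  qed
qed

text \<open>The expression of the transported pairing in a Darboux frame.\<close>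

lemma dual_pairing_darboux:
  fixes B :: "int ^ 'n \<Rightarrow> int ^ 'n \<Rightarrow> int" and gt g :: "nat \<Rightarrow> int ^ 'n"
  assumes add: "\<And>\<gamma>. Modules.additive (B \<gamma>)"
    and skew: "\<And>\<gamma> \<gamma>'. B \<gamma>' \<gamma> = - B \<gamma> \<gamma>'"
    and null: "\<And>\<gamma> \<phi>. \<phi> \<in> F \<Longrightarrow> B \<gamma> \<phi> = 0"
    and basis: "quotient_basis UNIV F ({..<r} <+> {..<r}) (case_sum gt g)"
    and darboux: "\<And>i j. i < r \<Longrightarrow> j < r \<Longrightarrow> B (gt i) (g j) = (if i = j then 1 else 0)"
      "\<And>i j. i < r \<Longrightarrow> j < r \<Longrightarrow> B (gt i) (gt j) = 0" "\<And>i j. i < r \<Longrightarrow> j < r \<Longrightarrow> B (g i) (g j) = 0"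
    and \<xi>: "Modules.additive \<xi>" "\<And>\<phi>. \<phi> \<in> F \<Longrightarrow> \<xi> \<phi> = 0"
    and \<eta>: "Modules.additive \<eta>" "\<And>\<phi>. \<phi> \<in> F \<Longrightarrow> \<eta> \<phi> = 0"
  shows "dual_pairing B \<xi> \<eta> = (\<Sum>i<r. \<xi> (gt i) * \<eta> (g i) - \<xi> (g i) * \<eta> (gt i))"
proof -
  define cv :: "int ^ 'n \<Rightarrow> complex ^ 'n" where "cv \<gamma> = (\<chi> i. of_int (\<gamma> $ i))" for \<gamma>
  define lift where "lift \<zeta> = (\<Sum>i<r. \<zeta> (g i) *s cv (gt i) - \<zeta> (gt i) *s cv (g i))" for \<zeta>
  have exp: "f \<gamma> = (\<Sum>j\<in>UNIV. of_int (\<gamma> $ j) * f (axis j 1))"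
    if "Modules.additive f" for f :: "int ^ 'n \<Rightarrow> int" and \<gamma>
    using additive_sum_scale[OF that, of UNIV "\<lambda>j. \<gamma> $ j" "\<lambda>j. axis j 1"]
    by (simp add: basis_expansion)
  have addl: "Modules.additive (\<lambda>\<gamma>. B \<gamma> \<gamma>')" for \<gamma>'
  proof
    fix x y
    show "B (x + y) \<gamma>' = B x \<gamma>' + B y \<gamma>'"
      using additive.add[OF add, of \<gamma>' x y] skew[of "x + y" \<gamma>'] skew[of x \<gamma>'] skew[of y \<gamma>']
      by linarith
  qed
  have val: "complexified B (cv \<gamma>) (cv \<gamma>') = of_int (B \<gamma> \<gamma>')" for \<gamma> \<gamma>'
  proof -
    have "B \<gamma> \<gamma>' = (\<Sum>i\<in>UNIV. \<gamma> $ i * B (axis i 1) \<gamma>')" using exp[OF addl, of \<gamma> \<gamma>'] by simp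
    also have "\<dots> = (\<Sum>i\<in>UNIV. \<gamma> $ i * (\<Sum>j\<in>UNIV. \<gamma>' $ j * B (axis i 1) (axis j 1)))"
      using exp[OF add, of _ \<gamma>'] by simp
    finally have "of_int (B \<gamma> \<gamma>') =
        (of_int (\<Sum>i\<in>UNIV. \<gamma> $ i * (\<Sum>j\<in>UNIV. \<gamma>' $ j * B (axis i 1) (axis j 1))) :: complex)"
      by (rule arg_cong)
    then show ?thesis by (simp add: complexified_def cv_def sum_distrib_left mult.assoc)
  qed
  have lift: "complexified B (lift \<zeta>) y =
      (\<Sum>i<r. \<zeta> (g i) * complexified B (cv (gt i)) y - \<zeta> (gt i) * complexified B (cv (g i)) y)" for \<zeta> y
  proof -
    have plus: "complexified B (x + x') y = complexified B x y + complexified B x' y" for x x'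
      by (simp add: complexified_def algebra_simps sum.distrib)
    have scale: "complexified B (k *s x) y = k * complexified B x y" for k x
      by (simp add: complexified_def sum_distrib_left mult.assoc)
    interpret Modules.additive "\<lambda>x. complexified B x y" by standard (rule plus)
    show ?thesis unfolding lift_def by (simp add: sum diff scale)
  qed
  have eval: "\<zeta> \<gamma> = complexified B (lift \<zeta>) (cv \<gamma>)"
    if \<zeta>: "Modules.additive \<zeta>" "\<And>\<phi>. \<phi> \<in> F \<Longrightarrow> \<zeta> \<phi> = 0" for \<zeta> \<gamma>
  proof -
    obtain c where c: "\<gamma> - (\<Sum>i\<in>{..<r} <+> {..<r}. c i *s case_sum gt g i) \<in> F"
      using basis unfolding quotient_basis_def by blast
    define p q where "p i = c (Inl i)" and "q i = c (Inr i)" for i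
    define \<phi> where "\<phi> = \<gamma> - ((\<Sum>i<r. p i *s gt i) + (\<Sum>i<r. q i *s g i))"
    have \<phi>: "\<phi> \<in> F" using c by (simp add: sum.Plus \<phi>_def p_def q_def o_def)
    have \<gamma>: "\<gamma> = (\<Sum>i<r. p i *s gt i) + (\<Sum>i<r. q i *s g i) + \<phi>" by (simp add: \<phi>_def)
    have B: "B \<gamma>' \<gamma> = (\<Sum>i<r. p i * B \<gamma>' (gt i)) + (\<Sum>i<r. q i * B \<gamma>' (g i))" for \<gamma>'
      by (subst \<gamma>) (simp add: additive.add[OF add] additive_sum_scale[OF add] null[OF \<phi>])
    have 1: "B (gt i) \<gamma> = q i" if "i < r" for i
      using that by (simp add: B darboux if_distrib[of "(*) _"] cong: if_cong)
    have 2: "B (g i) \<gamma> = - p i" if "i < r" for i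
    proof -
      have "B (g i) (gt j) = - (if i = j then 1 else 0)" if "j < r" for j
        using skew[of "g i" "gt j"] darboux(1)[of j i] that \<open>i < r\<close> by auto
      then show ?thesis
        using that by (simp add: B darboux if_distrib[of "(*) _"] sum_negf cong: if_cong)
    qed
    have "\<zeta> \<gamma> = (\<Sum>i<r. of_int (p i) * \<zeta> (gt i)) + (\<Sum>i<r. of_int (q i) * \<zeta> (g i))"
      by (subst \<gamma>) (simp add: additive.add[OF \<zeta>(1)] additive_sum_scale[OF \<zeta>(1)] \<zeta>(2)[OF \<phi>])
    then show ?thesis
      by (simp add: lift val 1 2 sum.distrib algebra_simps)
  qed
  have "dual_pairing B \<xi> \<eta> = complexified B (lift \<xi>) (lift \<eta>)"
    using eval[OF \<xi>] eval[OF \<eta>] unfolding cv_def by (intro dual_pairing_unique[OF skew])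
  also have "\<dots> = (\<Sum>i<r. \<xi> (g i) * complexified B (cv (gt i)) (lift \<eta>)
      - \<xi> (gt i) * complexified B (cv (g i)) (lift \<eta>))" by (rule lift)
  also have "\<dots> = (\<Sum>i<r. \<xi> (gt i) * \<eta> (g i) - \<xi> (g i) * \<eta> (gt i))"
  proof -
    have sk: "complexified B x y = - complexified B y x" for x y
    proof -
      have "complexified B x y =
          (\<Sum>j\<in>UNIV. \<Sum>i\<in>UNIV. x $ i * y $ j * of_int (B (axis i 1) (axis j 1)))"
        unfolding complexified_def by (rule sum.swap)
      also have "\<dots> = (\<Sum>j\<in>UNIV. \<Sum>i\<in>UNIV. - (y $ j * x $ i * of_int (B (axis j 1) (axis i 1))))"
        by (intro sum.cong refl, subst skew) (simp add: algebra_simps)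
      finally show ?thesis by (simp add: complexified_def sum_negf)
    qed
    have "complexified B (cv \<gamma>) (lift \<eta>) = - \<eta> \<gamma>" for \<gamma>
      by (subst sk) (simp flip: eval[OF \<eta>])
    then show ?thesis by simp
  qed
  finally show ?thesis .
qed

text \<open>The two-form \<open>\<langle>dX \<and> dY\<rangle>\<close>, with \<open>(\<alpha> \<and> \<beta>)(u, v) = \<alpha>(u) \<beta>(v) - \<alpha>(v) \<beta>(u)\<close>.\<close>

definition wedge_pairing ::
    "('v::euclidean_space, 'n::finite) charge_tuple \<Rightarrow> ('v \<Rightarrow> int ^ 'n \<Rightarrow> complex)
      \<Rightarrow> ('v \<Rightarrow> int ^ 'n \<Rightarrow> complex) \<Rightarrow> 'v \<Rightarrow> 'v \<Rightarrow> 'v \<Rightarrow> complex" where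
  "wedge_pairing G X Y x u v =
     dual_pairing (pairing G x) (dcharge G X x u) (dcharge G Y x v) -
     dual_pairing (pairing G x) (dcharge G X x v) (dcharge G Y x u)"

definition ASK_form ::
    "('v::euclidean_space, 'n::finite) charge_tuple \<Rightarrow> 'v \<Rightarrow> 'v \<Rightarrow> 'v \<Rightarrow> complex" where
  "ASK_form G x u v =
     1/4 * wedge_pairing G (charge G) (\<lambda>y \<gamma>. cnj (charge G y \<gamma>)) x u v"

definition ASK_metric ::
    "('v::euclidean_space \<Rightarrow> 'v) \<Rightarrow> ('v, 'n::finite) charge_tuple \<Rightarrow> 'v \<Rightarrow> 'v \<Rightarrow> 'v \<Rightarrow> complex" where
  "ASK_metric J G x u v = ASK_form G x u (J v)"

text \<open>
  If \<open>(gt, g)\<close> is a Darboux frame then so is \<open>(g, - gt)\<close>; hence, quantifying over all local Darboux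
  frames, it makes no difference whether the first condition is imposed on the forms
  \<open>dZ\<close> of \<open>g\<close>, of \<open>gt\<close>, or of both.
\<close>

definition central_charge_ASK_geometry ::
    "('v::euclidean_space \<Rightarrow> 'v) \<Rightarrow> ('v, 'n::finite) charge_tuple \<Rightarrow> bool" where
  "central_charge_ASK_geometry J G \<longleftrightarrow>
     central_charge_setting J G \<and>
     (\<forall>U gt g. open U \<and> U \<subseteq> base G \<and> darboux_frame G U gt g \<longrightarrow>
        (\<forall>x\<in>U.
           cotangent_basis J (cdim TYPE('v))
             (\<lambda>i. frechet_derivative (\<lambda>y. charge G y (g i y)) (at x)) \<and>
           cotangent_basis J (cdim TYPE('v))
             (\<lambda>i. frechet_derivative (\<lambda>y. charge G y (gt i y)) (at x)))) \<and>
     (\<forall>x\<in>base G. \<forall>u v. wedge_pairing G (charge G) (charge G) x u v = 0) \<and>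
     (\<forall>x\<in>base G. \<forall>u. (\<forall>v. ASK_form G x u v = 0) \<longrightarrow> u = 0)"


section \<open>The resolved conifold\<close>

definition conifold_base :: "complex set" where
  "conifold_base = {t. t \<noteq> 0 \<and> \<bar>Re t\<bar> < 1/2 \<and> 2 * Re (exp (2 * of_real pi * \<i> * t)) \<noteq> 1}"

definition conifold_plus :: "complex set" where
  "conifold_plus = {t \<in> conifold_base. 2 * Re (exp (2 * of_real pi * \<i> * t)) > 1}"

definition conifold_minus :: "complex set" where
  "conifold_minus = {t \<in> conifold_base. 2 * Re (exp (2 * of_real pi * \<i> * t)) < 1}"

definition neg_imag_axis :: "complex set" where
  "neg_imag_axis = {t. Re t = 0 \<and> Im t \<le> 0}"

text \<open>The principal branch of \<open>Li\<^sub>2\<close>: the analytic continuation of \<open>\<Sum>k\<ge>1. z\<^sup>k / k\<^sup>2\<close> to the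
  complement of the branch cut \<open>[1, \<infinity>)\<close>.\<close>

definition dilog :: "complex \<Rightarrow> complex" where
  "dilog z = - contour_integral (linepath 0 z) (\<lambda>u. Ln (1 - u) / u)"

definition charge_formula :: "complex \<Rightarrow> complex" where
  "charge_formula t =
     - (1 / (2 * of_real pi * \<i>)\<^sup>2) *
       (1/2 * (Ln (exp (2 * of_real pi * \<i> * t)))\<^sup>2 + dilog (exp (2 * of_real pi * \<i> * t)))"

abbreviation lat_delta :: "int ^ 3" where "lat_delta \<equiv> axis 1 1"
abbreviation lat_beta :: "int ^ 3" where "lat_beta \<equiv> axis 2 1"
abbreviation lat_betav :: "int ^ 3" where "lat_betav \<equiv> axis 3 1"

text \<open>
  Every fibre is \<open>\<int>\<^sup>3\<close> with basis \<open>lat_delta\<close>, \<open>lat_beta\<close>, \<open>lat_betav\<close>. Away from the negative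
  imaginary axis this is the flat frame \<open>(\<delta>, \<beta>, \<beta>\<^sup>\<or>)\<close>; over a point of the axis,
  \<open>lat_betav\<close> is the continuation of \<open>\<beta>\<^sup>\<or>\<close> from the left. The counterclockwise direction at the
  negative imaginary axis is from left to right, so the flat continuation of \<open>lat_betav\<close> across the
  axis is \<open>lat_betav + lat_beta\<close> on the right. The second trivialization is characterized
  by sending this continuation to the third basis vector: on the right it maps
  \<open>a \<delta> + b \<beta> + c \<beta>\<^sup>\<or> = a \<delta> + (b - c) \<beta> + c (\<beta>\<^sup>\<or> + \<beta>)\<close> to \<open>(a, b - c, c)\<close>.
\<close>

definition conifold_trivs :: "(complex, 3) trivialization set" where
  "conifold_trivs =
     {(conifold_base - neg_imag_axis, \<lambda>t \<gamma>. \<gamma>),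
      (conifold_base \<inter> {t. Im t < 0},
       \<lambda>t \<gamma>. if Re t \<le> 0 then \<gamma> else \<gamma> - (\<gamma> $ 3) *s lat_beta)}"

lemma locally_constant_on_const: "locally_constant_on U (\<lambda>x. c)"
  unfolding locally_constant_on_def constant_on_def by (auto intro: exI[of _ UNIV])

lemma locally_constant_on_split:
  assumes "open A" "open B" "U \<subseteq> A \<union> B"
    "\<And>x. x \<in> U \<inter> A \<Longrightarrow> f x = c" "\<And>x. x \<in> U \<inter> B \<Longrightarrow> f x = d"
  shows "locally_constant_on U f"
  unfolding locally_constant_on_def constant_on_def
proof
  fix x assume "x \<in> U"
  then consider "x \<in> A" | "x \<in> B" using assms(3) by blast
  then show "\<exists>V. open V \<and> x \<in> V \<and> (\<exists>y. \<forall>x\<in>U \<inter> V. f x = y)"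
  proof cases
    case 1 with assms(1,4) show ?thesis by (intro exI[of _ A]) auto
  next
    case 2 with assms(2,5) show ?thesis by (intro exI[of _ B]) auto
  qed
qed

lemma open_conifold_base: "open conifold_base"
proof -
  have "conifold_base = - {0} \<inter> {t. \<bar>Re t\<bar> < 1/2} \<inter> {t. 2 * Re (exp (2 * of_real pi * \<i> * t)) \<noteq> 1}"
    by (auto simp: conifold_base_def)
  moreover have "open {t::complex. \<bar>Re t\<bar> < 1/2}"
    by (intro open_Collect_less continuous_intros)
  moreover have "open {t. 2 * Re (exp (2 * of_real pi * \<i> * t)) \<noteq> 1}"
    by (intro open_Collect_neq continuous_intros)
  ultimately show ?thesis by (metis open_Int open_delete open_UNIV Compl_eq_Diff_UNIV)
qed

lemma open_conifold_cut: "open (conifold_base - neg_imag_axis)"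
proof -
  have "neg_imag_axis = {t. Re t = 0} \<inter> {t. Im t \<le> 0}" by (auto simp: neg_imag_axis_def)
  moreover have "closed {t. Re t = 0}" "closed {t. Im t \<le> 0}"
    by (auto intro!: closed_Collect_eq closed_Collect_le continuous_intros)
  ultimately show ?thesis using open_conifold_base by (metis closed_Int open_Diff)
qed

lemma open_conifold_lower: "open (conifold_base \<inter> {t. Im t < 0})"
  by (intro open_Int open_conifold_base open_Collect_less continuous_intros)

lemma conifold_flat_delta: "flat_section conifold_base conifold_trivs conifold_base (\<lambda>t. lat_delta)"
  and conifold_flat_beta: "flat_section conifold_base conifold_trivs conifold_base (\<lambda>t. lat_beta)"
proof -
  have "lat_delta $ 3 = 0" "lat_beta $ 3 = 0" by (simp_all add: axis_def)
  then show "flat_section conifold_base conifold_trivs conifold_base (\<lambda>t. lat_delta)"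
    "flat_section conifold_base conifold_trivs conifold_base (\<lambda>t. lat_beta)"
    by (simp_all add: flat_section_def conifold_trivs_def open_conifold_base
        locally_constant_on_const cong: if_cong)
qed

lemma conifold_flat_betav:
  "flat_section conifold_base conifold_trivs (conifold_base - neg_imag_axis) (\<lambda>t. lat_betav)"
proof -
  have "lat_betav $ 3 = 1" by (simp add: axis_def)
  moreover have "locally_constant_on ((conifold_base - neg_imag_axis) \<inter> (conifold_base \<inter> {t. Im t < 0}))
       (\<lambda>t. if Re t \<le> 0 then lat_betav else lat_betav - lat_beta)"
    by (rule locally_constant_on_split[where A = "{t. Re t < 0}" and B = "{t. Re t > 0}"
          and c = lat_betav and d = "lat_betav - lat_beta"])
       (auto simp: neg_imag_axis_def open_halfspace_Re_lt open_halfspace_Re_gt)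
  ultimately show ?thesis
    by (simp add: flat_section_def conifold_trivs_def open_conifold_cut locally_constant_on_const
        cong: if_cong)
qed

lemma conifold_flat_betav_continued:
  "flat_section conifold_base conifold_trivs (conifold_base \<inter> {t. Im t < 0})
     (\<lambda>t. if Re t \<le> 0 then lat_betav else lat_betav + lat_beta)"
proof -
  have "lat_betav $ 3 = 1" "lat_beta $ 3 = 0" by (simp_all add: axis_def)
  then have "(if Re t \<le> 0 then (if Re t \<le> 0 then lat_betav else lat_betav + lat_beta)
      else (if Re t \<le> 0 then lat_betav else lat_betav + lat_beta)
        - ((if Re t \<le> 0 then lat_betav else lat_betav + lat_beta) $ 3) *s lat_beta) = lat_betav" for t
    by simp
  moreover have "locally_constant_on ((conifold_base \<inter> {t. Im t < 0}) \<inter> (conifold_base - neg_imag_axis))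
     (\<lambda>t. if Re t \<le> 0 then lat_betav else lat_betav + lat_beta)"
    by (rule locally_constant_on_split[where A = "{t. Re t < 0}" and B = "{t. Re t > 0}"
          and c = lat_betav and d = "lat_betav + lat_beta"])
       (auto simp: neg_imag_axis_def open_halfspace_Re_lt open_halfspace_Re_gt)
  ultimately show ?thesis
    unfolding flat_section_def conifold_trivs_def
    using open_conifold_lower by (simp add: locally_constant_on_const)
qed

text \<open>
  The flat continuation of \<open>\<beta>\<^sup>\<or>\<close> from the left determines its central charge on the negative
  imaginary axis as the limit of the formula from the left.
\<close>

definition conifold_charge :: "complex \<Rightarrow> int ^ 3 \<Rightarrow> complex" where
  "conifold_charge t \<gamma> =
     of_int (\<gamma> $ 1) + of_int (\<gamma> $ 2) * t +
     of_int (\<gamma> $ 3) *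
       (if t \<in> neg_imag_axis then Lim (at t within {s. Re s < 0}) charge_formula
        else charge_formula t)"

definition resolved_conifold :: "(complex, 3) charge_tuple" where
  "resolved_conifold =
     \<lparr>base = conifold_base,
      trivs = conifold_trivs,
      flavour = (\<lambda>t. range (\<lambda>k. k *s lat_delta)),
      pairing = (\<lambda>t \<gamma> \<gamma>'. \<gamma> $ 3 * \<gamma>' $ 2 - \<gamma> $ 2 * \<gamma>' $ 3),
      charge = conifold_charge\<rparr>"

end

theory Submission
  imports Defs
begin

text \<open>
  Write \<open>q = exp (2 \<pi> \<i> t)\<close>. The complex dimension is one and \<open>Z\<^sub>\<beta> = t\<close>, so everything is decided by
  the single function \<open>\<tau> = dZ\<^sub>\<beta>\<^sub>\<or> / dt\<close>. Differentiating the dilogarithm gives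
  \<open>\<tau> = - t - \<i> / (2 \<pi>) Ln (1 - q)\<close>. For a Darboux frame, the derivatives of the charges are
  \<open>m + n \<tau>\<close> with integers \<open>m, n\<close> that are not both zero; these are non-zero as soon as \<open>\<tau>\<close> is
  not real, which is the frame condition. The condition \<open>\<langle>dZ \<and> dZ\<rangle> = 0\<close> holds because there are no
  holomorphic two-forms in dimension one, and the two-form is
  \<open>\<omega> = \<i> / 2 Im \<tau> dt \<and> d(cnj t)\<close>. Hence the metric is \<open>Im \<tau> \<bar>dt\<bar>\<^sup>2\<close>,
  and all remaining claims concern the sign and the smoothness of \<open>Im \<tau>\<close>. From
  \<open>- Im t = ln \<bar>q\<bar> / (2 \<pi>)\<close> one gets
  \<open>Im \<tau> = (ln \<bar>q\<bar> - ln \<bar>1 - q\<bar>) / (2 \<pi>)\<close>, and \<open>\<bar>1 - q\<bar>\<^sup>2 = \<bar>q\<bar>\<^sup>2 + 1 - 2 Re q\<close> shows that its sign is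
  that of \<open>2 Re q - 1\<close> (\<open>Im_tau_pos\<close>, \<open>Im_tau_neg\<close>).

  The analytic content is that \<open>Z\<close> really extends over the negative imaginary axis compatibly with
  the monodromy \<open>\<beta>\<^sup>\<or> \<mapsto> \<beta>\<^sup>\<or> + \<beta>\<close>. Comparing derivatives on the two sides would leave an integration
  constant undetermined. The reflection formula
  \<open>Li\<^sub>2 q + Li\<^sub>2 (1 - q) + Ln q Ln (1 - q) = C\<close> (\<open>dilog_reflection\<close>) avoids this: near
  the axis \<open>Li\<^sub>2 (1 - q)\<close> and \<open>Ln q\<close> are holomorphic, so the jump of \<open>Z\<^sub>\<beta>\<^sub>\<or>\<close> is exactly that of
  \<open>Ln q Ln (1 - q)\<close>, which is explicit. The result is \<open>charge_formula_continuation\<close>, and its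
  consequence \<open>has_field_derivative_charge_flat\<close> differentiates the charge of every flat section at
  every point of the base by the same formula \<open>m + n \<tau>\<close>.
\<close>

text \<open>The infix notation for coefficients of formal power series would make \<open>\<gamma> $ i\<close> ambiguous.\<close>

no_notation fps_nth (infixl \<open>$\<close> 75)


section \<open>The dilogarithm\<close>

lemma closed_segment_slit_plane:
  assumes "z \<in> {z::complex. 1 - z \<notin> \<real>\<^sub>\<le>\<^sub>0}"
  shows "closed_segment 0 z \<subseteq> {z. 1 - z \<notin> \<real>\<^sub>\<le>\<^sub>0}"
proof
  fix w assume "w \<in> closed_segment 0 z"
  then obtain u where u: "0 \<le> u" "u \<le> 1" "w = of_real u * z"
    by (auto simp: closed_segment_def scaleR_conv_of_real)
  have False if w: "Im w = 0" "1 \<le> Re w"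
  proof -
    have *: "u \<noteq> 0" "Im z = 0" "1 \<le> u * Re z" using w u by auto
    have "0 < Re z"
    proof (rule ccontr)
      assume "\<not> 0 < Re z"
      then have "u * Re z \<le> 0" using u(1) by (simp add: mult_nonneg_nonpos)
      then show False using * by simp
    qed
    then have "u * Re z \<le> Re z" using u by (intro mult_left_le_one_le) auto
    then have "1 \<le> Re z" using * by linarith
    then show False using assms * by (simp add: complex_nonpos_Reals_iff)
  qed
  then show "w \<in> {z. 1 - z \<notin> \<real>\<^sub>\<le>\<^sub>0}" by (auto simp: complex_nonpos_Reals_iff)
qed

lemma open_slit_plane: "open {z::complex. 1 - z \<notin> \<real>\<^sub>\<le>\<^sub>0}"
proof -
  have "{z::complex. 1 - z \<notin> \<real>\<^sub>\<le>\<^sub>0} = (\<lambda>z. 1 - z) -` (- \<real>\<^sub>\<le>\<^sub>0)" by auto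
  then show ?thesis by (auto intro!: open_vimage continuous_intros)
qed

text \<open>
  After filling in the value \<open>- 1\<close> at the origin, the integrand is continuous on the slit plane and
  holomorphic away from \<open>0\<close>. As the slit plane is starlike about \<open>0\<close>, it has a primitive there, and
  integrating along the radius returns this primitive.
\<close>

lemma has_field_derivative_dilog:
  assumes "1 - z \<notin> \<real>\<^sub>\<le>\<^sub>0" "z \<noteq> 0"
  shows "(dilog has_field_derivative - Ln (1 - z) / z) (at z)"
proof -
  define S :: "complex set" where "S = {z. 1 - z \<notin> \<real>\<^sub>\<le>\<^sub>0}"
  define h :: "complex \<Rightarrow> complex" where "h u = (if u = 0 then -1 else Ln (1 - u) / u)" for u
  have opS: "open S" unfolding S_def by (rule open_slit_plane)
  have "0 \<in> S" by (simp add: S_def)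
  then have stS: "starlike S"
    using closed_segment_slit_plane unfolding S_def starlike_def by blast
  have diff: "h field_differentiable at u" if "u \<in> S - {0}" for u
  proof -
    have u: "1 - u \<notin> \<real>\<^sub>\<le>\<^sub>0" "u \<noteq> 0" using that by (simp_all add: S_def)
    have "((\<lambda>u. 1 - u) has_field_derivative -1) (at u)" by (auto intro!: derivative_eq_intros)
    then have "((\<lambda>u. Ln (1 - u)) has_field_derivative inverse (1 - u) * -1) (at u)"
      by (rule DERIV_chain2[where f = Ln and g = "\<lambda>u. 1 - u", OF has_field_derivative_Ln[OF u(1)]])
    then obtain D where "((\<lambda>u. Ln (1 - u) / u) has_field_derivative D) (at u)"
      using DERIV_divide[OF _ DERIV_ident u(2)] by blast
    then have "(h has_field_derivative D) (at u)"
      by (rule has_field_derivative_transform_within_open[where S = "- {0}"])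
         (use that in \<open>auto simp: h_def\<close>)
    then show ?thesis by (auto simp: field_differentiable_def)
  qed
  have "isCont h u" if "u \<in> S" for u
  proof (cases "u = 0")
    case True
    have "((\<lambda>u. Ln (1 - u)) has_field_derivative -1) (at 0)"
      by (auto intro!: derivative_eq_intros simp: complex_nonpos_Reals_iff)
    then have "((\<lambda>u. Ln (1 - u) / u) \<longlongrightarrow> -1) (at 0)" by (simp add: has_field_derivative_iff)
    then have "(h \<longlongrightarrow> -1) (at 0)"
      by (rule Lim_transform_within_open[OF _ open_UNIV UNIV_I]) (auto simp: h_def)
    then show ?thesis using True by (simp add: isCont_def h_def)
  next
    case False
    then show ?thesis using diff that by (auto intro: field_differentiable_imp_continuous_at)
  qed
  then have "continuous_on S h" by (simp add: continuous_at_imp_continuous_on)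
  then obtain P where P: "\<And>x. x \<in> S \<Longrightarrow> (P has_field_derivative h x) (at x)"
    using holomorphic_starlike_primitive[of S h "{0}"] stS opS diff by blast
  have dil: "dilog w = P 0 - P w" if w: "w \<in> S" for w
  proof -
    have "closed_segment 0 w \<subseteq> S"
      using closed_segment_slit_plane w unfolding S_def .
    then have "(h has_contour_integral (P w - P 0)) (linepath 0 w)"
      using contour_integral_primitive[of S P h "linepath 0 w"] P
      by (auto intro: has_field_derivative_at_within)
    then have "((\<lambda>x. h (linepath 0 w x) * (w - 0)) has_integral P w - P 0) {0..1}"
      by (simp add: has_contour_integral_linepath)
    \<comment> \<open>The two integrands differ only at the origin, a single point of the path.\<close>
    then have "((\<lambda>x. Ln (1 - linepath 0 w x) / linepath 0 w x * (w - 0)) has_integral P w - P 0) {0..1}"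
      by (rule has_integral_spike_finite[of "{0}", rotated 2]) (auto simp: h_def linepath_def)
    then have "((\<lambda>u. Ln (1 - u) / u) has_contour_integral P w - P 0) (linepath 0 w)"
      by (simp add: has_contour_integral_linepath)
    then show ?thesis by (simp add: dilog_def contour_integral_unique)
  qed
  have z: "z \<in> S" using assms by (simp add: S_def)
  have "((\<lambda>w. P 0 - P w) has_field_derivative - h z) (at z)"
    by (auto intro!: derivative_eq_intros P z)
  then have "(dilog has_field_derivative - h z) (at z)"
    by (rule has_field_derivative_transform_within_open[OF _ opS z]) (simp add: dil)
  then show ?thesis using assms by (simp add: h_def)
qed

text \<open>
  By the product rule the derivative of \<open>Li\<^sub>2 z + Li\<^sub>2 (1 - z) + Ln z Ln (1 - z)\<close> vanishes, and the
  plane with both cuts removed is starlike about \<open>1/2\<close>, hence connected: one constant serves both sides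
  of the cut \<open>[1, \<infinity>)\<close>.
\<close>

lemma dilog_reflection:
  obtains C where "\<And>z. z \<notin> \<real>\<^sub>\<le>\<^sub>0 \<Longrightarrow> 1 - z \<notin> \<real>\<^sub>\<le>\<^sub>0 \<Longrightarrow> dilog z = C - dilog (1 - z) - Ln z * Ln (1 - z)"
proof -
  define S :: "complex set" where "S = {z. z \<notin> \<real>\<^sub>\<le>\<^sub>0 \<and> 1 - z \<notin> \<real>\<^sub>\<le>\<^sub>0}"
  have "S = - \<real>\<^sub>\<le>\<^sub>0 \<inter> {z. 1 - z \<notin> \<real>\<^sub>\<le>\<^sub>0}" by (auto simp: S_def)
  then have opS: "open S" using open_slit_plane by (auto intro!: open_Int)
  have "starlike S"
    unfolding starlike_def
  proof (rule bexI[of _ "1/2"], intro ballI subsetI)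
    fix z w assume z: "z \<in> S" and "w \<in> closed_segment (1/2) z"
    then obtain u where u: "0 \<le> u" "u \<le> 1" "w = of_real (1 - u) * (1/2) + of_real u * z"
      by (auto simp: closed_segment_def scaleR_conv_of_real)
    have "0 < Re w \<and> Re w < 1" if "Im w = 0"
    proof (cases "u = 0")
      case False
      then have *: "Im z = 0" using that u by simp
      with z have "0 < Re z" "Re z < 1" by (auto simp: S_def complex_nonpos_Reals_iff)
      moreover have "Re w = (1 - u) * (1/2) + u * Re z" using u by simp
      moreover have "0 < u" using u False by simp
      ultimately have "0 < u * Re z" "u * Re z < u" by auto
      then have "0 < Re w" "Re w < 1" using \<open>Re w = _\<close> u(1,2) by argo+
      then show ?thesis by simp
    next
      case True
      then have "w = of_real (1/2)" using u by simp
      then have "Re w = Re (of_real (1/2))" by (rule arg_cong)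
      then have "Re w = 1/2" by (simp only: Re_complex_of_real)
      then show ?thesis by simp
    qed
    then show "w \<in> S" by (auto simp: S_def complex_nonpos_Reals_iff)
  qed (auto simp: S_def complex_nonpos_Reals_iff)
  then have conn: "connected S" by (rule starlike_imp_connected)
  have "((\<lambda>z. dilog z + dilog (1 - z) + Ln z * Ln (1 - z)) has_field_derivative 0) (at z)"
    if "z \<in> S" for z
  proof -
    from that have z: "z \<notin> \<real>\<^sub>\<le>\<^sub>0" "1 - z \<notin> \<real>\<^sub>\<le>\<^sub>0" "z \<noteq> 0" "1 - z \<noteq> 0" by (auto simp: S_def)
    have 1: "(dilog has_field_derivative - Ln (1 - z) / z) (at z)"
      by (rule has_field_derivative_dilog) (use z in simp_all)
    have "(dilog has_field_derivative - Ln (1 - (1 - z)) / (1 - z)) (at (1 - z))"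
      by (rule has_field_derivative_dilog) (use z in simp_all)
    moreover have 0: "((\<lambda>z. 1 - z) has_field_derivative -1) (at z)"
      by (auto intro!: derivative_eq_intros)
    ultimately have 2: "((\<lambda>z. dilog (1 - z)) has_field_derivative - Ln (1 - (1 - z)) / (1 - z) * -1) (at z)"
      by (rule DERIV_chain2[where f = dilog and g = "\<lambda>z. 1 - z"])
    have 3: "((\<lambda>z. Ln (1 - z)) has_field_derivative inverse (1 - z) * -1) (at z)"
      by (rule DERIV_chain2[where f = Ln and g = "\<lambda>z. 1 - z", OF has_field_derivative_Ln[OF z(2)] 0])
    show ?thesis
      using DERIV_add[OF DERIV_add[OF 1 2] DERIV_mult[OF has_field_derivative_Ln[OF z(1)] 3]]
      by (rule DERIV_cong) (use z(3,4) in \<open>simp add: divide_inverse\<close>)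
  qed
  then have "(\<lambda>z. dilog z + dilog (1 - z) + Ln z * Ln (1 - z)) constant_on S"
    by (rule has_field_derivative_0_imp_constant_on[OF _ conn opS])
  then obtain C where C: "\<And>z. z \<in> S \<Longrightarrow> dilog z + dilog (1 - z) + Ln z * Ln (1 - z) = C"
    unfolding constant_on_def by blast
  show thesis
  proof
    fix z :: complex assume "z \<notin> \<real>\<^sub>\<le>\<^sub>0" "1 - z \<notin> \<real>\<^sub>\<le>\<^sub>0"
    then have "dilog z + dilog (1 - z) + Ln z * Ln (1 - z) = C" by (intro C) (simp add: S_def)
    then show "dilog z = C - dilog (1 - z) - Ln z * Ln (1 - z)" by (simp add: algebra_simps)
  qed
qed

section \<open>The central charge near the branch cut\<close>

abbreviation q_exp :: "complex \<Rightarrow> complex" where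
  "q_exp t \<equiv> exp (2 * of_real pi * \<i> * t)"

lemma Ln_q_exp: "\<bar>Re t\<bar> < 1/2 \<Longrightarrow> Ln (q_exp t) = 2 * of_real pi * \<i> * t"
proof (rule Ln_exp)
  assume "\<bar>Re t\<bar> < 1/2"
  then have "2 * pi * \<bar>Re t\<bar> < 2 * pi * (1/2)" by (intro mult_strict_left_mono) auto
  then have "\<bar>2 * pi * Re t\<bar> < pi" by (simp add: abs_mult)
  then have "- pi < 2 * pi * Re t" "2 * pi * Re t \<le> pi" by linarith+
  moreover have "Im (2 * of_real pi * \<i> * t) = 2 * pi * Re t" by simp
  ultimately show "- pi < Im (2 * of_real pi * \<i> * t)" "Im (2 * of_real pi * \<i> * t) \<le> pi"
    by (simp_all only:)
qed

text \<open>
  In the strip, \<open>q\<close> has argument \<open>2 \<pi> Re t\<close> strictly between \<open>- \<pi>\<close> and \<open>\<pi>\<close>, so it is a positive real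
  only on the imaginary axis, and there it is at least \<open>1\<close> exactly on the lower half.
\<close>

lemma q_exp_cut_iff:
  assumes "\<bar>Re t\<bar> < 1/2"
  shows "1 - q_exp t \<in> \<real>\<^sub>\<le>\<^sub>0 \<longleftrightarrow> t \<in> neg_imag_axis"
proof -
  have "2 * pi * \<bar>Re t\<bar> < 2 * pi * (1/2)" using assms by (intro mult_strict_left_mono) auto
  then have b: "\<bar>2 * pi * Re t\<bar> < pi" by (simp add: abs_mult)
  then have "sin (2 * pi * Re t) = 0 \<longleftrightarrow> Re t = 0"
    using sin_eq_0_pi[of "2 * pi * Re t"]
    by (metis abs_less_iff minus_less_iff mult_eq_0_iff pi_neq_zero sin_zero zero_neq_numeral)
  then show ?thesis
    by (auto simp: complex_nonpos_Reals_iff Re_exp Im_exp neg_imag_axis_def mult_le_0_iff)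
       (use pi_gt_zero in linarith)
qed

lemma q_exp_ne_1:
  assumes "t \<in> conifold_base"
  shows "q_exp t \<noteq> 1"
proof
  assume "q_exp t = 1"
  moreover have "\<bar>Re t\<bar> < 1/2" "t \<noteq> 0" using assms by (auto simp: conifold_base_def)
  ultimately show False using Ln_q_exp[of t] by simp
qed

text \<open>
  The derivative of \<open>Z\<close> along \<open>\<beta>\<^sup>\<or>\<close>. On the negative imaginary axis \<open>1 - q\<close> is a negative real, where
  the principal logarithm has imaginary part \<open>\<pi>\<close>; this is its limit from the left, so the formula
  gives there the derivative along the continuation of \<open>\<beta>\<^sup>\<or>\<close> from the left.
\<close>

definition tau :: "complex \<Rightarrow> complex" where
  "tau t = - t - \<i> / (2 * of_real pi) * Ln (1 - q_exp t)"

lemma has_field_derivative_charge_formula: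
  assumes t: "\<bar>Re t\<bar> < 1/2" "t \<notin> neg_imag_axis"
  shows "(charge_formula has_field_derivative tau t) (at t)"
proof -
  let ?f = "\<lambda>t. - (1 / (2 * of_real pi * \<i>)\<^sup>2) * (1/2 * (2 * of_real pi * \<i> * t)\<^sup>2 + dilog (q_exp t))"
  have "(dilog has_field_derivative - Ln (1 - q_exp t) / q_exp t) (at (q_exp t))"
    by (rule has_field_derivative_dilog) (use t q_exp_cut_iff[OF t(1)] in auto)
  then have d: "((\<lambda>t. dilog (q_exp t)) has_field_derivative
      - Ln (1 - q_exp t) / q_exp t * (q_exp t * (2 * of_real pi * \<i>))) (at t)"
    by (rule DERIV_chain2[where f = dilog and g = q_exp]) (auto intro!: derivative_eq_intros)
  have s: "((\<lambda>t. 1/2 * (2 * of_real pi * \<i> * t)\<^sup>2) has_field_derivative (2 * of_real pi * \<i>)\<^sup>2 * t) (at t)"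
    by (auto intro!: derivative_eq_intros simp: power2_eq_square)
  have "(?f has_field_derivative tau t) (at t)"
    by (rule DERIV_cong[OF DERIV_cmult[OF DERIV_add[OF s d]]])
       (simp add: tau_def power2_eq_square field_simps)
  then show ?thesis
  proof (rule has_field_derivative_transform_within_open)
    show "open {t. \<bar>Re t\<bar> < 1/2}" by (intro open_Collect_less continuous_intros)
  qed (use t in \<open>auto simp: charge_formula_def Ln_q_exp\<close>)
qed

text \<open>
  From \<open>1 - q = - q (1 - 1/q)\<close>. In the lower half plane \<open>\<bar>1/q\<bar> < 1\<close>, so that \<open>Ln (1 - 1/q)\<close> is
  holomorphic across the axis, and the jump of \<open>Ln (1 - q)\<close> comes from the choice of \<open>Ln (- q)\<close> alone.
\<close>

lemma Ln_one_minus_q_exp: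
  assumes t: "\<bar>Re t\<bar> < 1/2" "Im t < 0"
  shows "Ln (1 - q_exp t) = 2 * of_real pi * \<i> * t + (if Re t \<le> 0 then of_real pi * \<i> else - (of_real pi * \<i>))
      + Ln (1 - 1 / q_exp t)"
proof (rule Ln_unique)
  let ?w = "1 - 1 / q_exp t"
  have inv: "1 / q_exp t = exp (- (2 * of_real pi * \<i> * t))" by (simp add: exp_minus field_simps)
  have b: "2 * pi * \<bar>Re t\<bar> < pi"
    using t mult_strict_left_mono[of "\<bar>Re t\<bar>" "1/2" "2 * pi"] by simp
  have "norm (1 / q_exp t) < 1"
    using t by (simp add: inv mult_pos_neg mult_neg_pos)
  then have re: "0 < Re ?w" using complex_Re_le_cmod[of "1 / q_exp t"] by simp
  then have half: "\<bar>Im (Ln ?w)\<bar> < pi / 2" by (rule Re_Ln_pos_lt_imp)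
  have w0: "?w \<noteq> 0" using re by auto
  have im: "Im ?w = exp (2 * pi * Im t) * sin (2 * pi * Re t)" by (simp add: inv Im_exp)
  \<comment> \<open>The signs below keep the sum of the arguments within the principal range.\<close>
  have l: "Im (Ln ?w) \<le> 0" if "Re t \<le> 0"
  proof (rule ccontr)
    assume "\<not> Im (Ln ?w) \<le> 0"
    then have "0 < Im ?w" using Im_Ln_pos_lt[OF w0] half by auto
    moreover have "sin (2 * pi * Re t) \<le> 0"
      using sin_ge_zero[of "- (2 * pi * Re t)"] b that by (simp add: mult_nonneg_nonpos)
    ultimately show False unfolding im by (simp add: zero_less_mult_iff)
  qed
  have r: "Im (Ln ?w) \<ge> 0" if "Re t > 0"
  proof -
    have "sin (2 * pi * Re t) \<ge> 0" using sin_ge_zero[of "2 * pi * Re t"] b that by simp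
    then have "0 \<le> Im ?w" unfolding im by simp
    then show ?thesis using Im_Ln_pos_le[OF w0] by auto
  qed
  let ?s = "if Re t \<le> 0 then of_real pi * \<i> else - (of_real pi * \<i>)"
  have "exp (2 * of_real pi * \<i> * t + ?s + Ln ?w) = q_exp t * (-1) * ?w"
    using w0 by (auto simp: exp_add exp_minus)
  also have "\<dots> = 1 - q_exp t" by (simp add: field_simps)
  finally show "exp (2 * of_real pi * \<i> * t + ?s + Ln ?w) = 1 - q_exp t" .
  have "Im (2 * of_real pi * \<i> * t + ?s + Ln ?w) = 2 * pi * Re t + (if Re t \<le> 0 then pi else - pi) + Im (Ln ?w)"
    by simp
  note * = this
  have "2 * pi * Re t \<le> 0" if "Re t \<le> 0" using that by (simp add: mult_nonneg_nonpos)
  moreover have "2 * pi * Re t > 0" if "Re t > 0" using that by simp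
  moreover have "\<bar>2 * pi * Re t\<bar> < pi" using b by (simp add: abs_mult)
  ultimately have "- pi < 2 * pi * Re t + (if Re t \<le> 0 then pi else - pi) + Im (Ln ?w) \<and>
    2 * pi * Re t + (if Re t \<le> 0 then pi else - pi) + Im (Ln ?w) \<le> pi"
  proof (cases "Re t \<le> 0")
    case True
    with l \<open>Re t \<le> 0 \<Longrightarrow> 2 * pi * Re t \<le> 0\<close> have "Im (Ln ?w) \<le> 0" "2 * pi * Re t \<le> 0" by blast+
    then show ?thesis using half \<open>\<bar>2 * pi * Re t\<bar> < pi\<close> unfolding if_P[OF True] by linarith
  next
    case False
    then have "Im (Ln ?w) \<ge> 0" "2 * pi * Re t > 0"
      using r \<open>0 < Re t \<Longrightarrow> 2 * pi * Re t > 0\<close> by simp_all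
    then show ?thesis using half \<open>\<bar>2 * pi * Re t\<bar> < pi\<close> unfolding if_not_P[OF False] by linarith
  qed
  then show "- pi < Im (2 * of_real pi * \<i> * t + ?s + Ln ?w)"
    "Im (2 * of_real pi * \<i> * t + ?s + Ln ?w) \<le> pi"
    by (simp_all only: *)
qed

text \<open>
  The reflection formula replaces \<open>Li\<^sub>2 q\<close> by \<open>C - Li\<^sub>2 (1 - q) - 2 \<pi> \<i> t Ln (1 - q)\<close>, where by
  \<open>Ln_one_minus_q_exp\<close> the last factor is a holomorphic function plus \<open>\<plusminus> \<pi> \<i>\<close>. After
  division by \<open>(2 \<pi> \<i>)\<^sup>2\<close> the latter contributes \<open>t / 2\<close> on the left of the axis and \<open>- t / 2\<close> on the
  right. The continuation from the left therefore exceeds the formula by \<open>t = Z\<^sub>\<beta>\<close> on the right, which is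
  the jump of \<open>\<beta>\<^sup>\<or>\<close>. The strip is narrowed to \<open>\<bar>Re t\<bar> < 1/4\<close> to keep \<open>Re q\<close> positive, away from the cut
  of \<open>Li\<^sub>2 (1 - q)\<close>.
\<close>

lemma charge_formula_continuation:
  obtains G where
    "\<And>t. \<bar>Re t\<bar> < 1/4 \<Longrightarrow> Im t < 0 \<Longrightarrow> (G has_field_derivative 1/2 - \<i> / (2 * of_real pi) * Ln (1 - 1 / q_exp t)) (at t)"
    "\<And>t. \<bar>Re t\<bar> < 1/4 \<Longrightarrow> Im t < 0 \<Longrightarrow> Re t < 0 \<Longrightarrow> G t = charge_formula t"
    "\<And>t. \<bar>Re t\<bar> < 1/4 \<Longrightarrow> Im t < 0 \<Longrightarrow> Re t > 0 \<Longrightarrow> G t = charge_formula t + t"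
proof -
  obtain C where C: "\<And>z. z \<notin> \<real>\<^sub>\<le>\<^sub>0 \<Longrightarrow> 1 - z \<notin> \<real>\<^sub>\<le>\<^sub>0 \<Longrightarrow> dilog z = C - dilog (1 - z) - Ln z * Ln (1 - z)"
    using dilog_reflection by blast
  let ?p = "2 * of_real pi * \<i> :: complex"
  \<comment> \<open>The dilogarithm term rewritten by reflection, with \<open>Ln (1 - q)\<close> replaced by its holomorphic part
    \<open>2 \<pi> \<i> t + Ln (1 - 1/q)\<close>; the summand \<open>t / 2\<close> in \<open>G\<close> restores the value on the left of the axis.\<close>
  define H where "H t = 1/2 * (?p * t)\<^sup>2 + C - dilog (1 - q_exp t) - ?p * t * (?p * t + Ln (1 - 1 / q_exp t))" for t
  define G where "G t = t / 2 - (1 / ?p\<^sup>2) * H t" for t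
  have off_cut: "q_exp t \<notin> \<real>\<^sub>\<le>\<^sub>0" if "\<bar>Re t\<bar> < 1/4" for t
  proof -
    have "2 * pi * \<bar>Re t\<bar> < pi / 2"
      using that mult_strict_left_mono[of "\<bar>Re t\<bar>" "1/4" "2 * pi"] by simp
    then have "\<bar>2 * pi * Re t\<bar> < pi / 2" by (simp add: abs_mult)
    then have "cos (2 * pi * Re t) > 0" by (intro cos_gt_zero_pi) linarith+
    then show ?thesis by (auto simp: complex_nonpos_Reals_iff Re_exp mult_le_0_iff not_le[symmetric])
  qed
  have big: "norm (1 / q_exp t) < 1" if "Im t < 0" for t
    using that by (simp add: norm_divide mult_pos_neg mult_neg_pos)
  show thesis
  proof
    fix t assume t: "\<bar>Re t\<bar> < 1/4" "Im t < 0"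
    then have t': "\<bar>Re t\<bar> < 1/2" by simp
    have ne: "q_exp t \<noteq> 1" using big[OF t(2)] by auto
    have re: "0 < Re (1 - 1 / q_exp t)"
      using big[OF t(2)] complex_Re_le_cmod[of "1 / q_exp t"] by simp
    have "(dilog has_field_derivative - Ln (1 - (1 - q_exp t)) / (1 - q_exp t)) (at (1 - q_exp t))"
      by (rule has_field_derivative_dilog) (use off_cut[OF t(1)] ne in auto)
    then have d: "(dilog has_field_derivative - (?p * t) / (1 - q_exp t)) (at (1 - q_exp t))"
      by (simp add: Ln_q_exp[OF t'])
    have 1: "((\<lambda>t. dilog (1 - q_exp t)) has_field_derivative
        - (?p * t) / (1 - q_exp t) * (- (q_exp t * ?p))) (at t)"
      by (rule DERIV_chain2[where f = dilog and g = "\<lambda>t. 1 - q_exp t", OF d]) (auto intro!: derivative_eq_intros)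
    have 2: "((\<lambda>t. Ln (1 - 1 / q_exp t)) has_field_derivative ?p / (q_exp t - 1)) (at t)"
    proof -
      have "1 - 1 / q_exp t \<notin> \<real>\<^sub>\<le>\<^sub>0" using re by (auto simp: complex_nonpos_Reals_iff)
      then have "(Ln has_field_derivative inverse (1 - 1 / q_exp t)) (at (1 - 1 / q_exp t))"
        by (rule has_field_derivative_Ln)
      moreover have "((\<lambda>t. 1 - 1 / q_exp t) has_field_derivative ?p / q_exp t) (at t)"
        by (auto intro!: derivative_eq_intros simp: field_simps)
      ultimately have "((\<lambda>t. Ln (1 - 1 / q_exp t)) has_field_derivative
          inverse (1 - 1 / q_exp t) * (?p / q_exp t)) (at t)"
        by (rule DERIV_chain2)
      then show ?thesis by (rule DERIV_cong) (use ne in \<open>simp add: field_simps\<close>)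
    qed
    have 3: "((\<lambda>t. ?p * t) has_field_derivative ?p) (at t)"
      by (auto intro!: derivative_eq_intros)
    have 4: "((\<lambda>t. 1/2 * (?p * t)\<^sup>2 + C) has_field_derivative ?p * t * ?p) (at t)"
      by (auto intro!: derivative_eq_intros)
    have alg: "p * t * p - (- (p * t) / (1 - q) * (- (q * p))) - (p * (p * t + L) + (p + p / (q - 1)) * (p * t))
        = - p * L" if "q \<noteq> 1" for p q L :: complex
      using that by (simp add: divide_simps) (simp add: algebra_simps)
    have "(H has_field_derivative - ?p * Ln (1 - 1 / q_exp t)) (at t)"
      unfolding H_def
      by (rule DERIV_cong[OF DERIV_diff[OF DERIV_diff[OF 4 1] DERIV_mult[OF 3 DERIV_add[OF 3 2]]] alg[OF ne]])
    then have "(G has_field_derivative 1 / 2 - (1 / ?p\<^sup>2) * (- ?p * Ln (1 - 1 / q_exp t))) (at t)"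
      unfolding G_def by (intro DERIV_diff DERIV_cmult) (auto intro!: derivative_eq_intros)
    then show "(G has_field_derivative 1/2 - \<i> / (2 * of_real pi) * Ln (1 - 1 / q_exp t)) (at t)"
      by (rule DERIV_cong) (simp add: power2_eq_square field_simps)
    have "charge_formula t = - (1 / ?p\<^sup>2) * (1/2 * (?p * t)\<^sup>2 + C - dilog (1 - q_exp t) - ?p * t * Ln (1 - q_exp t))"
      if "Re t \<noteq> 0"
    proof -
      have "1 - q_exp t \<notin> \<real>\<^sub>\<le>\<^sub>0" using that t' by (simp add: q_exp_cut_iff neg_imag_axis_def)
      then show ?thesis
        unfolding charge_formula_def C[OF off_cut[OF t(1)] \<open>1 - q_exp t \<notin> \<real>\<^sub>\<le>\<^sub>0\<close>] Ln_q_exp[OF t']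
        by (simp only: add_diff_eq)
    qed
    note * = this[unfolded Ln_one_minus_q_exp[OF t' t(2)]]
    show "Re t < 0 \<Longrightarrow> G t = charge_formula t" 
      using * by (simp add: G_def H_def power2_eq_square field_simps)
    show "Re t > 0 \<Longrightarrow> G t = charge_formula t + t"
      using * by (simp add: G_def H_def power2_eq_square field_simps)
  qed
qed

lemma tau_lower:
  assumes t: "\<bar>Re t\<bar> < 1/2" "Im t < 0" "Re t \<le> 0"
  shows "tau t = 1/2 - \<i> / (2 * of_real pi) * Ln (1 - 1 / q_exp t)"
  using Ln_one_minus_q_exp[OF t(1,2)] t(3) unfolding tau_def by (simp add: field_simps)

section \<open>The sign and the smoothness of the imaginary part of tau\<close>

lemma Im_tau:
  assumes "t \<in> conifold_base"
  shows "Im (tau t) = (ln (norm (q_exp t)) - ln (norm (1 - q_exp t))) / (2 * pi)"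
proof -
  have "1 - q_exp t \<noteq> 0" using q_exp_ne_1[OF assms] by simp
  then show ?thesis by (simp add: tau_def field_simps)
qed

text \<open>
  Geometrically, \<open>q\<close> is compared by its distance to \<open>0\<close> and to \<open>1\<close>; the bisector is \<open>Re q = 1/2\<close>.
\<close>

lemma norm_q_exp_less_iff:
  "norm (1 - q_exp t) < norm (q_exp t) \<longleftrightarrow> 1 < 2 * Re (q_exp t)"
  "norm (q_exp t) < norm (1 - q_exp t) \<longleftrightarrow> 2 * Re (q_exp t) < 1"
proof -
  have "(norm (1 - z))\<^sup>2 = (norm z)\<^sup>2 + (1 - 2 * Re z)" for z :: complex
    by (simp add: cmod_power2) (simp add: power2_eq_square algebra_simps)
  note * = this[of "q_exp t"]
  have sq: "x < y \<longleftrightarrow> x\<^sup>2 < y\<^sup>2" if "0 \<le> x" "0 \<le> y" for x y :: real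
    using that by (meson power_less_imp_less_base power_strict_mono zero_less_numeral)
  show "norm (1 - q_exp t) < norm (q_exp t) \<longleftrightarrow> 1 < 2 * Re (q_exp t)"
    "norm (q_exp t) < norm (1 - q_exp t) \<longleftrightarrow> 2 * Re (q_exp t) < 1"
    unfolding sq[OF norm_ge_zero norm_ge_zero] * by linarith+
qed

lemma Im_tau_pos: "t \<in> conifold_plus \<Longrightarrow> 0 < Im (tau t)"
proof -
  assume t: "t \<in> conifold_plus"
  then have b: "t \<in> conifold_base" and "1 < 2 * Re (q_exp t)" by (auto simp: conifold_plus_def)
  then have "norm (1 - q_exp t) < norm (q_exp t)" by (simp only: norm_q_exp_less_iff)
  moreover have "0 < norm (1 - q_exp t)" using q_exp_ne_1[OF b] by simp
  ultimately have "ln (norm (1 - q_exp t)) < ln (norm (q_exp t))" by (metis ln_less_cancel_iff order_less_trans)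
  then have "0 < ln (norm (q_exp t)) - ln (norm (1 - q_exp t))" by (simp only: diff_gt_0_iff_gt)
  then show ?thesis unfolding Im_tau[OF b] by (rule divide_pos_pos) simp
qed

lemma Im_tau_neg: "t \<in> conifold_minus \<Longrightarrow> Im (tau t) < 0"
proof -
  assume t: "t \<in> conifold_minus"
  then have b: "t \<in> conifold_base" and "2 * Re (q_exp t) < 1" by (auto simp: conifold_minus_def)
  then have "norm (q_exp t) < norm (1 - q_exp t)" by (simp only: norm_q_exp_less_iff)
  then have "ln (norm (q_exp t)) < ln (norm (1 - q_exp t))"
    by (metis exp_not_eq_zero ln_less_cancel_iff order_less_trans zero_less_norm_iff)
  then have "ln (norm (q_exp t)) - ln (norm (1 - q_exp t)) < 0" by (simp only: diff_less_0_iff_less)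
  then show ?thesis unfolding Im_tau[OF b] by (rule divide_neg_pos) simp
qed

lemma conifold_base_cases: "t \<in> conifold_base \<Longrightarrow> t \<in> conifold_plus \<or> t \<in> conifold_minus"
  by (auto simp: conifold_base_def conifold_plus_def conifold_minus_def)

lemma Im_tau_nonzero: "t \<in> conifold_base \<Longrightarrow> Im (tau t) \<noteq> 0"
  using conifold_base_cases Im_tau_pos Im_tau_neg by force

text \<open>
  The jump of \<open>\<tau>\<close> across the axis is real, so its imaginary part is smooth on the whole base; it is the
  imaginary part of a local primitive of the global holomorphic function \<open>- 1 / (1 - q)\<close>.
\<close>

lemma Im_tau_has_derivative:
  assumes t: "t \<in> conifold_base"
  shows "((\<lambda>t. Im (tau t)) has_derivative (\<lambda>v. Im (- 1 / (1 - q_exp t) * v))) (at t)"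
proof -
  let ?w = "1 - q_exp t"
  have w: "?w \<noteq> 0" using q_exp_ne_1[OF t] by simp
  have "((\<lambda>t. 1 - q_exp t) has_field_derivative - (q_exp t * (2 * of_real pi * \<i>))) (at t)"
    by (auto intro!: derivative_eq_intros)
  then have d: "((\<lambda>t. 1 - q_exp t) has_derivative (\<lambda>v. - (q_exp t * (2 * of_real pi * \<i>)) * v)) (at t)"
    by (simp only: has_field_derivative_def)
  have "((\<lambda>t. norm (1 - q_exp t)) has_derivative
      (\<lambda>v. (- (q_exp t * (2 * of_real pi * \<i>)) * v) \<bullet> sgn ?w)) (at t)"
    using has_derivative_compose[OF d has_derivative_norm[OF w]] .
  then have 1: "((\<lambda>t. ln (norm (1 - q_exp t))) has_derivative
      (\<lambda>v. ((- (q_exp t * (2 * of_real pi * \<i>)) * v) \<bullet> sgn ?w) / norm ?w)) (at t)"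
    using w by (auto intro!: derivative_eq_intros simp: field_simps)
  have inn: "(x \<bullet> sgn y) / norm y = Re (x / y)" for x y :: complex
  proof -
    have "(x \<bullet> sgn y) / norm y = (x \<bullet> y) / (norm y)\<^sup>2"
      by (simp add: sgn_div_norm power2_eq_square divide_inverse)
    then show ?thesis by (simp add: Re_divide inner_complex_def cmod_power2)
  qed
  have "((\<lambda>t. - Im t - ln (norm (1 - q_exp t)) / (2 * pi)) has_derivative
      (\<lambda>v. - Im v - Re (- (q_exp t * (2 * of_real pi * \<i>)) * v / ?w) / (2 * pi))) (at t)"
    by (intro has_derivative_diff bounded_linear.has_derivative[OF bounded_linear_divide 1[unfolded inn]])
       (auto intro!: derivative_eq_intros)
  moreover have "- Im v - Re (- (q_exp t * (2 * of_real pi * \<i>)) * v / ?w) / (2 * pi) = Im (- 1 / ?w * v)" for v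
  proof -
    have "Re (- (q_exp t * (2 * of_real pi * \<i>)) * v / ?w) = 2 * pi * Im (q_exp t * v / ?w)"
    proof -
      have "- (q_exp t * (2 * of_real pi * \<i>)) * v / ?w = - (of_real (2 * pi) * (\<i> * (q_exp t * v / ?w)))"
        by simp
      moreover have "Re (- (of_real r * (\<i> * z))) = r * Im z" for r z by simp
      ultimately show ?thesis by (simp only:)
    qed
    then have "- Im v - Re (- (q_exp t * (2 * of_real pi * \<i>)) * v / ?w) / (2 * pi) = Im (- v - q_exp t * v / ?w)"
      by simp
    also have "- v - q_exp t * v / ?w = - 1 / ?w * v" using w by (simp add: field_simps)
    finally show ?thesis .
  qed
  ultimately have "((\<lambda>t. - Im t - ln (norm (1 - q_exp t)) / (2 * pi)) has_derivative
      (\<lambda>v. Im (- 1 / ?w * v))) (at t)" by simp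
  then show ?thesis
  proof (rule has_derivative_transform_within_open[OF _ open_conifold_base t])
    show "- Im s - ln (norm (1 - q_exp s)) / (2 * pi) = Im (tau s)" if "s \<in> conifold_base" for s
      using q_exp_ne_1[OF that] by (simp add: tau_def)
  qed
qed

lemma Ck_on_cong:
  assumes U: "open U"
  shows "(\<And>x. x \<in> U \<Longrightarrow> f x = g x) \<Longrightarrow> Ck_on k U f \<longleftrightarrow> Ck_on k U g"
proof (induction k arbitrary: f g)
  case 0 then show ?case by (auto intro: continuous_on_cong)
next
  case (Suc k)
  have d: "(f has_derivative D) (at x) \<longleftrightarrow> (g has_derivative D) (at x)" if "x \<in> U" for x D
    using has_derivative_transform_within_open[OF _ U that, of f D UNIV g]
      has_derivative_transform_within_open[OF _ U that, of g D UNIV f] Suc.prems by auto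
  then have "f differentiable (at x) \<longleftrightarrow> g differentiable (at x)" if "x \<in> U" for x
    using that by (simp add: differentiable_def)
  moreover have "frechet_derivative f (at x) v = frechet_derivative g (at x) v" if "x \<in> U" for x v
    using d[OF that] by (simp add: frechet_derivative_def)
  then have "Ck_on k U (\<lambda>x. frechet_derivative f (at x) v) \<longleftrightarrow> Ck_on k U (\<lambda>x. frechet_derivative g (at x) v)" for v
    by (rule Suc.IH)
  ultimately show ?case by simp
qed

lemma Ck_on_Suc_has_derivative:
  assumes U: "open U" and d: "\<And>x. x \<in> U \<Longrightarrow> (f has_derivative D x) (at x)"
    and D: "\<And>v. Ck_on k U (\<lambda>x. D x v)"
  shows "Ck_on (Suc k) U f"
proof -
  have "Ck_on k U (\<lambda>x. frechet_derivative f (at x) v)" for v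
    using D[of v] Ck_on_cong[OF U, of "\<lambda>x. frechet_derivative f (at x) v" "\<lambda>x. D x v" k]
      frechet_derivative_at[OF d] by simp
  then show ?thesis using d by (auto simp: differentiable_def)
qed

lemma Ck_on_Im_holomorphic:
  assumes U: "open U"
  shows "h holomorphic_on U \<Longrightarrow> Ck_on k U (\<lambda>x. of_real (Im (h x)))"
proof (induction k arbitrary: h)
  case 0
  then show ?case by (auto intro!: continuous_intros holomorphic_on_imp_continuous_on)
next
  case (Suc k)
  show ?case
  proof (rule Ck_on_Suc_has_derivative[OF U])
    fix x assume "x \<in> U"
    then have "(h has_derivative (\<lambda>v. deriv h x * v)) (at x)"
      using holomorphic_derivI[OF Suc.prems U] by (simp only: has_field_derivative_def)
    then show "((\<lambda>x. complex_of_real (Im (h x))) has_derivative (\<lambda>v. of_real (Im (deriv h x * v)))) (at x)"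
      by (intro bounded_linear.has_derivative[OF bounded_linear_of_real] bounded_linear.has_derivative[OF bounded_linear_Im])
  next
    fix v
    show "Ck_on k U (\<lambda>x. of_real (Im (deriv h x * v)))"
      by (rule Suc.IH) (intro holomorphic_intros holomorphic_deriv Suc.prems U)
  qed
qed

text \<open>
  One differentiation leads from \<open>Im \<tau>\<close>, where \<open>\<tau>\<close> itself is discontinuous, to the imaginary part of
  a function that is holomorphic on the base.
\<close>

lemma Ck_on_Im_tau:
  assumes U: "open U" "U \<subseteq> conifold_base"
  shows "Ck_on k U (\<lambda>x. of_real (Im (tau x) * r))"
proof -
  have Im_of_real_mult: "Im (z * of_real r) = Im z * r" for z by simp
  have "Ck_on (Suc k') U (\<lambda>x. of_real (Im (tau x) * r))" for k'
  proof (rule Ck_on_Suc_has_derivative[OF U(1)])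
    fix x assume "x \<in> U"
    then show "((\<lambda>x. complex_of_real (Im (tau x) * r)) has_derivative
        (\<lambda>v. of_real (Im (- 1 / (1 - q_exp x) * v) * r))) (at x)"
      using U by (intro bounded_linear.has_derivative[OF bounded_linear_of_real] has_derivative_mult_left Im_tau_has_derivative) auto
  next
    fix v
    have "(\<lambda>x. - 1 / (1 - q_exp x) * v * of_real r) holomorphic_on U"
      using q_exp_ne_1 U by (intro holomorphic_intros) force
    then have "Ck_on k' U (\<lambda>x. of_real (Im (- 1 / (1 - q_exp x) * v * of_real r)))"
      by (rule Ck_on_Im_holomorphic[OF U(1)])
    then show "Ck_on k' U (\<lambda>x. of_real (Im (- 1 / (1 - q_exp x) * v) * r))"
      by (simp only: Im_of_real_mult)
  qed
  note S = this
  show ?thesis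
  proof (cases k)
    case 0
    have "continuous_on U (\<lambda>x. complex_of_real (Im (tau x) * r))"
      using S[of 0] by (auto intro!: continuous_at_imp_continuous_on differentiable_imp_continuous_within)
    then show ?thesis using 0 by simp
  qed (use S in simp)
qed

section \<open>Flat sections and their charges\<close>

lemma lat_components:
  "lat_delta $ 2 = 0" "lat_delta $ 3 = 0" "lat_beta $ 2 = 1" "lat_beta $ 3 = 0"
  "lat_betav $ 2 = 0" "lat_betav $ 3 = 1"
  by (simp_all add: axis_def)

lemma neg_imag_axis_base:
  assumes "x \<in> conifold_base" "x \<in> neg_imag_axis"
  shows "Im x < 0" "Re x = 0"
  using assms by (auto simp: neg_imag_axis_def conifold_base_def complex_eq_iff order_less_le)

lemma local_system_conifold: "local_system conifold_base conifold_trivs"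
proof -
  let ?M = "conifold_base - neg_imag_axis" and ?L = "conifold_base \<inter> {t. Im t < 0}"
  let ?\<phi> = "\<lambda>(t::complex) (\<gamma>::int^3). \<gamma>"
  let ?\<psi> = "\<lambda>(t::complex) (\<gamma>::int^3). if Re t \<le> 0 then \<gamma> else \<gamma> - (\<gamma> $ 3) *s lat_beta"
  \<comment> \<open>The shear by which the second trivialization differs from the first on the right of the axis.\<close>
  define sh :: "int^3 \<Rightarrow> int^3" where "sh = (\<lambda>\<gamma>. \<gamma> - (\<gamma> $ 3) *s lat_beta)"
  have "bij sh"
    by (rule o_bij[of "\<lambda>\<gamma>. \<gamma> + (\<gamma> $ 3) *s lat_beta"])
       (simp_all add: fun_eq_iff sh_def lat_components)
  moreover have psi: "?\<psi> t = (if Re t \<le> 0 then (\<lambda>\<gamma>. \<gamma>) else sh)" for t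
    by (simp add: sh_def)
  ultimately have bij: "bij (?\<psi> t)" for t by (simp add: bij_id[unfolded id_def])
  have add: "Modules.additive (?\<psi> t)" for t
    by (simp add: Modules.additive_def vector_sadd_rdistrib algebra_simps)
  have inv: "?\<psi> t \<circ> inv (?\<psi> t) = id" for t by (simp only: bij_is_surj[OF bij] surj_iff[symmetric])
  have const: "locally_constant_on (?M \<inter> ?L) (\<lambda>t. F (?\<psi> t))" for F :: "(int^3 \<Rightarrow> int^3) \<Rightarrow> int^3 \<Rightarrow> int^3"
    by (rule locally_constant_on_split[where A = "{t. Re t < 0}" and B = "{t. Re t > 0}"
          and c = "F (\<lambda>\<gamma>. \<gamma>)" and d = "F sh"])
       (auto simp: neg_imag_axis_def open_halfspace_Re_lt open_halfspace_Re_gt sh_def)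
  have cover: "conifold_base = ?M \<union> ?L"
    by (auto simp: neg_imag_axis_def conifold_base_def complex_eq_iff order_less_le)
  have LM: "?L \<inter> ?M = ?M \<inter> ?L" by blast
  show ?thesis
    unfolding local_system_def conifold_trivs_def
  proof (intro conjI)
    show "\<forall>(U, \<phi>)\<in>{(?M, ?\<phi>), (?L, ?\<psi>)}. open U \<and> U \<subseteq> conifold_base \<and> (\<forall>x\<in>U. bij (\<phi> x) \<and> Modules.additive (\<phi> x))"
      using open_conifold_cut open_conifold_lower bij add bij_id[unfolded id_def]
      by (auto simp: Modules.additive_def)
    show "conifold_base = (\<Union>(U, \<phi>)\<in>{(?M, ?\<phi>), (?L, ?\<psi>)}. U)" using cover by simp
    have "locally_constant_on (?M \<inter> ?L) (\<lambda>t. ?\<phi> t \<circ> inv (?\<psi> t))"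
      using const[of inv] by (simp add: o_def)
    moreover have "locally_constant_on (?L \<inter> ?M) (\<lambda>t. ?\<psi> t \<circ> inv (?\<phi> t))"
      unfolding LM by (rule const[of "\<lambda>f. f \<circ> inv (\<lambda>\<gamma>. \<gamma>)"])
    moreover have "locally_constant_on (?L \<inter> ?L) (\<lambda>t. ?\<psi> t \<circ> inv (?\<psi> t))"
      unfolding inv by (rule locally_constant_on_const)
    moreover have "locally_constant_on (?M \<inter> ?M) (\<lambda>t. ?\<phi> t \<circ> inv (?\<phi> t))"
      by (rule locally_constant_on_const)
    ultimately show "\<forall>(U, \<phi>)\<in>{(?M, ?\<phi>), (?L, ?\<psi>)}. \<forall>(V, \<psi>)\<in>{(?M, ?\<phi>), (?L, ?\<psi>)}.
        locally_constant_on (U \<inter> V) (\<lambda>x. \<phi> x \<circ> inv (\<psi> x))"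
      by (simp only: ball_simps prod.case simp_thms)
  qed
qed

text \<open>
  The fibres are identified with \<open>\<int>\<^sup>3\<close> discontinuously along the axis: a flat section through a point of
  the axis takes up a multiple of \<open>\<beta>\<close> on its right. Elsewhere flat sections are locally constant.
\<close>

lemma flat_section_germ:
  assumes s: "flat_section conifold_base conifold_trivs U s" and x: "x \<in> U"
  obtains V where "open V" "x \<in> V" "V \<subseteq> U"
    "\<And>y. y \<in> V \<Longrightarrow> s y = (if x \<in> neg_imag_axis \<and> 0 < Re y then s x + (s x $ 3) *s lat_beta else s x)"
proof -
  have U: "open U" "U \<subseteq> conifold_base"
    and 1: "locally_constant_on (U \<inter> (conifold_base - neg_imag_axis)) s"
    and 2: "locally_constant_on (U \<inter> (conifold_base \<inter> {t. Im t < 0}))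
      (\<lambda>t. if Re t \<le> 0 then s t else s t - (s t $ 3) *s lat_beta)"
    using s by (simp_all add: flat_section_def conifold_trivs_def)
  show thesis
  proof (cases "x \<in> neg_imag_axis")
    case False
    with x U have "x \<in> U \<inter> (conifold_base - neg_imag_axis)" by auto
    with 1 obtain V c where V: "open V" "x \<in> V" "\<And>y. y \<in> U \<inter> (conifold_base - neg_imag_axis) \<inter> V \<Longrightarrow> s y = c"
      unfolding locally_constant_on_def constant_on_def by metis
    show thesis
    proof (rule that[of "U \<inter> V \<inter> (conifold_base - neg_imag_axis)"])
      show "open (U \<inter> V \<inter> (conifold_base - neg_imag_axis))"
        by (intro open_Int U V open_conifold_cut)
      show "x \<in> U \<inter> V \<inter> (conifold_base - neg_imag_axis)" using x U V False by auto
      fix y assume "y \<in> U \<inter> V \<inter> (conifold_base - neg_imag_axis)"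
      then have "s y = c" "s x = c" using V x U False by auto
      then show "s y = (if x \<in> neg_imag_axis \<and> 0 < Re y then s x + (s x $ 3) *s lat_beta else s x)"
        using False by simp
    qed auto
  next
    case True
    with x U have xl: "x \<in> conifold_base" "Im x < 0" "Re x = 0"
      using neg_imag_axis_base[of x] by auto
    then have "x \<in> U \<inter> (conifold_base \<inter> {t. Im t < 0})" using x by auto
    with 2 obtain V c where V: "open V" "x \<in> V" "\<And>y. y \<in> U \<inter> (conifold_base \<inter> {t. Im t < 0}) \<inter> V \<Longrightarrow>
        (if Re y \<le> 0 then s y else s y - (s y $ 3) *s lat_beta) = c"
      unfolding locally_constant_on_def constant_on_def by metis
    show thesis
    proof (rule that[of "U \<inter> V \<inter> (conifold_base \<inter> {t. Im t < 0})"])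
      show "open (U \<inter> V \<inter> (conifold_base \<inter> {t. Im t < 0}))"
        by (intro open_Int[OF open_Int] U V open_conifold_lower)
      show "x \<in> U \<inter> V \<inter> (conifold_base \<inter> {t. Im t < 0})" using x xl V by auto
      fix y assume y: "y \<in> U \<inter> V \<inter> (conifold_base \<inter> {t. Im t < 0})"
      have sx: "s x = c" using V(3)[of x] V(2) x xl by auto
      have sy: "(if Re y \<le> 0 then s y else s y - (s y $ 3) *s lat_beta) = c" using V(3)[of y] y by auto
      show "s y = (if x \<in> neg_imag_axis \<and> 0 < Re y then s x + (s x $ 3) *s lat_beta else s x)"
      proof (cases "Re y \<le> 0")
        case True with sx sy show ?thesis by simp
      next
        case False
        then have c: "c = s y - (s y $ 3) *s lat_beta" using sy by simp
        moreover have "lat_beta $ 3 = 0" by (simp add: axis_def)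
        ultimately have "c $ 3 = s y $ 3" by simp
        moreover have "s y = c + (s y $ 3) *s lat_beta" using c by (simp only: diff_add_cancel)
        ultimately show ?thesis using False True sx by simp
      qed
    qed auto
  qed
qed

lemma flat_section_exists:
  assumes "x \<in> conifold_base"
  obtains U s where "x \<in> U" "flat_section conifold_base conifold_trivs U s" "s x = \<gamma>"
proof (cases "x \<in> neg_imag_axis")
  case False
  have "locally_constant_on ((conifold_base - neg_imag_axis) \<inter> (conifold_base \<inter> {t. Im t < 0}))
       (\<lambda>t. if Re t \<le> 0 then \<gamma> else \<gamma> - (\<gamma> $ 3) *s lat_beta)"
    by (rule locally_constant_on_split[where A = "{t. Re t < 0}" and B = "{t. Re t > 0}"
          and c = \<gamma> and d = "\<gamma> - (\<gamma> $ 3) *s lat_beta"])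
       (auto simp: neg_imag_axis_def open_halfspace_Re_lt open_halfspace_Re_gt)
  then have "flat_section conifold_base conifold_trivs (conifold_base - neg_imag_axis) (\<lambda>t. \<gamma>)"
    by (simp add: flat_section_def conifold_trivs_def open_conifold_cut locally_constant_on_const)
  then show thesis using that[of "conifold_base - neg_imag_axis" "\<lambda>t. \<gamma>"] assms False by simp
next
  case True
  have x: "Im x < 0" "Re x = 0"
    using neg_imag_axis_base[OF assms True] by simp_all
  let ?s = "\<lambda>t. if Re t \<le> 0 then \<gamma> else \<gamma> + (\<gamma> $ 3) *s lat_beta"
  have "lat_beta $ 3 = 0" by (simp add: axis_def)
  then have "(if Re t \<le> 0 then ?s t else ?s t - (?s t $ 3) *s lat_beta) = \<gamma>" for t by simp
  moreover have "locally_constant_on ((conifold_base \<inter> {t. Im t < 0}) \<inter> (conifold_base - neg_imag_axis)) ?s"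
    by (rule locally_constant_on_split[where A = "{t. Re t < 0}" and B = "{t. Re t > 0}"
          and c = \<gamma> and d = "\<gamma> + (\<gamma> $ 3) *s lat_beta"])
       (auto simp: neg_imag_axis_def open_halfspace_Re_lt open_halfspace_Re_gt)
  ultimately have "flat_section conifold_base conifold_trivs (conifold_base \<inter> {t. Im t < 0}) ?s"
    unfolding flat_section_def conifold_trivs_def
    using open_conifold_lower by (simp add: locally_constant_on_const)
  then show thesis using that[of "conifold_base \<inter> {t. Im t < 0}" ?s] assms x by simp
qed

text \<open>
  At a point of the axis the section jumps by a multiple of \<open>\<beta>\<close> and the charge of \<open>\<beta>\<^sup>\<or>\<close> jumps by the
  opposite multiple of \<open>Z\<^sub>\<beta> = t\<close>, so that both sides and the axis itself are described by the one
  continuation of the charge formula.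
\<close>

lemma has_field_derivative_charge_flat:
  assumes s: "flat_section conifold_base conifold_trivs U s" and x: "x \<in> U"
  shows "((\<lambda>y. conifold_charge y (s y)) has_field_derivative of_int (s x $ 2) + of_int (s x $ 3) * tau x) (at x)"
proof -
  obtain V where V: "open V" "x \<in> V" "V \<subseteq> U"
    "\<And>y. y \<in> V \<Longrightarrow> s y = (if x \<in> neg_imag_axis \<and> 0 < Re y then s x + (s x $ 3) *s lat_beta else s x)"
    by (rule flat_section_germ[OF s x]) blast
  have xb: "x \<in> conifold_base" using s x by (auto simp: flat_section_def)
  then have x2: "\<bar>Re x\<bar> < 1/2" by (simp add: conifold_base_def)
  have affine: "((\<lambda>y. a + b * y + c * f y) has_field_derivative b + c * d) (at x)"
    if "(f has_field_derivative d) (at x)" for a b c d :: complex and f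
    using that by (auto intro!: derivative_eq_intros)
  show ?thesis
  proof (cases "x \<in> neg_imag_axis")
    case False
    have "((\<lambda>y. of_int (s x $ 1) + of_int (s x $ 2) * y + of_int (s x $ 3) * charge_formula y)
        has_field_derivative of_int (s x $ 2) + of_int (s x $ 3) * tau x) (at x)"
      by (rule affine[OF has_field_derivative_charge_formula[OF x2 False]])
    then show ?thesis
    proof (rule has_field_derivative_transform_within_open)
      show "open (V \<inter> (conifold_base - neg_imag_axis))" by (intro open_Int V open_conifold_cut)
      show "x \<in> V \<inter> (conifold_base - neg_imag_axis)" using V(2) False xb by simp
      fix y assume y: "y \<in> V \<inter> (conifold_base - neg_imag_axis)"
      then have "s y = s x" using V(4)[of y] False by simp
      then show "of_int (s x $ 1) + of_int (s x $ 2) * y + of_int (s x $ 3) * charge_formula y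
          = conifold_charge y (s y)"
        using y by (simp add: conifold_charge_def)
    qed
  next
    case True
    have xl: "Im x < 0" "Re x = 0"
      using neg_imag_axis_base[OF xb True] by simp_all
    obtain G where G: 
      "\<And>t. \<bar>Re t\<bar> < 1/4 \<Longrightarrow> Im t < 0 \<Longrightarrow> (G has_field_derivative 1/2 - \<i> / (2 * of_real pi) * Ln (1 - 1 / q_exp t)) (at t)"
      "\<And>t. \<bar>Re t\<bar> < 1/4 \<Longrightarrow> Im t < 0 \<Longrightarrow> Re t < 0 \<Longrightarrow> G t = charge_formula t"
      "\<And>t. \<bar>Re t\<bar> < 1/4 \<Longrightarrow> Im t < 0 \<Longrightarrow> Re t > 0 \<Longrightarrow> G t = charge_formula t + t"
      by (rule charge_formula_continuation) blast
    define W where "W = {t. \<bar>Re t\<bar> < 1/4} \<inter> {t. Im t < 0}"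
    have W: "open W" unfolding W_def by (intro open_Int open_Collect_less continuous_intros)
    \<comment> \<open>On the axis the charge is defined as a limit from the left, which the continuation attains.\<close>
    have lim: "Lim (at t within {s. Re s < 0}) charge_formula = G t" if t: "t \<in> W" "Re t = 0" for t
    proof (rule tendsto_Lim)
      have "t \<in> closure {s. Re s < 0}"
        using t closure_halfspace_lt[of "1 :: complex" 0] by (simp add: inner_complex_def)
      then show "at t within {s. Re s < 0} \<noteq> bot"
        using t by (simp add: at_within_eq_bot_iff)
      have "isCont G t" using G(1)[of t] t by (auto simp: W_def intro: DERIV_isCont)
      then have "(G \<longlongrightarrow> G t) (at t within {s. Re s < 0})"
        unfolding isCont_def by (rule tendsto_within_subset) simp
      moreover have "eventually (\<lambda>s. G s = charge_formula s) (at t within {s. Re s < 0})"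
        unfolding eventually_at_topological
        by (intro exI[of _ W]) (use W t in \<open>auto simp: W_def intro: G(2)\<close>)
      ultimately show "(charge_formula \<longlongrightarrow> G t) (at t within {s. Re s < 0})"
        by (rule Lim_transform_eventually)
    qed
    have gt: "(G has_field_derivative tau x) (at x)"
      using G(1)[of x] tau_lower[OF x2] xl by simp
    have "((\<lambda>y. of_int (s x $ 1) + of_int (s x $ 2) * y + of_int (s x $ 3) * G y)
        has_field_derivative of_int (s x $ 2) + of_int (s x $ 3) * tau x) (at x)"
      by (rule affine[OF gt])
    then show ?thesis
    proof (rule has_field_derivative_transform_within_open)
      show "open (V \<inter> W)" by (intro open_Int V W)
      show "x \<in> V \<inter> W" using V(2) xl by (simp add: W_def)
      fix y assume y: "y \<in> V \<inter> W"
      show "of_int (s x $ 1) + of_int (s x $ 2) * y + of_int (s x $ 3) * G y = conifold_charge y (s y)"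
      proof (cases "Re y = 0")
        case eq: True
        then have "y \<in> neg_imag_axis" using y by (auto simp: W_def neg_imag_axis_def)
        then show ?thesis using V(4)[of y] y lim[of y] eq by (simp add: conifold_charge_def)
      next
        case ne: False
        then have na: "y \<notin> neg_imag_axis" by (simp add: neg_imag_axis_def)
        show ?thesis
        proof (cases "Re y < 0")
          case True
          then show ?thesis using V(4)[of y] y na G(2)[of y]
            by (simp add: conifold_charge_def W_def)
        next
          case False
          then have "0 < Re y" using ne by simp
          then show ?thesis using V(4)[of y] y na G(3)[of y] \<open>x \<in> neg_imag_axis\<close>
            by (simp add: conifold_charge_def W_def axis_def algebra_simps)
        qed
      qed
    qed
  qed
qed

section \<open>The lattice and its pairing\<close>

lemma resolved_conifold_simps [simp]:
  "base resolved_conifold = conifold_base"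
  "trivs resolved_conifold = conifold_trivs"
  "flavour resolved_conifold t = range (\<lambda>k. k *s lat_delta)"
  "pairing resolved_conifold t \<gamma> \<gamma>' = \<gamma> $ 3 * \<gamma>' $ 2 - \<gamma> $ 2 * \<gamma>' $ 3"
  "charge resolved_conifold = conifold_charge"
  by (simp_all add: resolved_conifold_def)

lemma cdim_complex [simp]: "cdim TYPE(complex) = Suc 0"
  by (simp add: cdim_def)

text \<open>
  Extensional coordinate functions that are determined on the index set are unique; this is the form in
  which coordinates with respect to a basis are required.
\<close>

lemma ex1_PiE:
  assumes "\<And>c. P c \<longleftrightarrow> (\<forall>i\<in>I. c i = f i)"
  shows "\<exists>!c. c \<in> I \<rightarrow>\<^sub>E UNIV \<and> P c"
proof (rule ex1I)
  show "restrict f I \<in> I \<rightarrow>\<^sub>E UNIV \<and> P (restrict f I)" by (simp add: assms)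
next
  fix c assume "c \<in> I \<rightarrow>\<^sub>E UNIV \<and> P c"
  then show "c = restrict f I"
    by (intro extensionalityI[of _ I]) (simp_all add: PiE_def assms)
qed

lemma mem_range_delta: "v \<in> range (\<lambda>k. k *s lat_delta) \<longleftrightarrow> v $ 2 = 0 \<and> v $ 3 = 0"
proof
  assume "v \<in> range (\<lambda>k. k *s lat_delta)"
  then show "v $ 2 = 0 \<and> v $ 3 = 0" by (auto simp: axis_def)
next
  assume "v $ 2 = 0 \<and> v $ 3 = 0"
  then have "v = (v $ 1) *s lat_delta" by (simp add: vec_eq_iff forall_3 axis_def)
  then show "v \<in> range (\<lambda>k. k *s lat_delta)" by blast
qed

text \<open>
  The shift by \<open>m\<close> is there because the flat continuation of \<open>\<beta>\<^sup>\<or>\<close> is \<open>\<beta>\<^sup>\<or> + \<beta>\<close> on one side of the axis.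
\<close>

lemma quotient_basis_conifold:
  "quotient_basis UNIV (range (\<lambda>k. k *s lat_delta)) ({..<Suc 0} <+> {..<Suc 0})
     (case_sum (\<lambda>i. lat_betav + m *s lat_beta) (\<lambda>i. lat_beta))"
  unfolding quotient_basis_def
proof (intro conjI ballI)
  fix \<gamma> :: "int ^ 3"
  have I: "{..<Suc 0} <+> {..<Suc 0} = {Inl 0, Inr 0}" by auto
  have iff: "\<gamma> - (\<Sum>i\<in>{..<Suc 0} <+> {..<Suc 0}. c i *s case_sum (\<lambda>i. lat_betav + m *s lat_beta) (\<lambda>i. lat_beta) i)
      \<in> range (\<lambda>k. k *s lat_delta) \<longleftrightarrow> c (Inl 0) = \<gamma> $ 3 \<and> c (Inr 0) = \<gamma> $ 2 - \<gamma> $ 3 * m" for c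
    proof -
    have "(\<Sum>i\<in>{Inl 0, Inr 0}. c i *s case_sum (\<lambda>i. lat_betav + m *s lat_beta) (\<lambda>i. lat_beta) i)
        = c (Inl 0) *s (lat_betav + m *s lat_beta) + c (Inr 0) *s lat_beta" by simp
    then show ?thesis unfolding mem_range_delta I
      by (simp add: lat_components) (auto simp: algebra_simps)
  qed
  show "\<exists>!c. c \<in> ({..<Suc 0} <+> {..<Suc 0}) \<rightarrow>\<^sub>E UNIV \<and>
      \<gamma> - (\<Sum>i\<in>{..<Suc 0} <+> {..<Suc 0}. c i *s case_sum (\<lambda>i. lat_betav + m *s lat_beta) (\<lambda>i. lat_beta) i)
      \<in> range (\<lambda>k. k *s lat_delta)"
    unfolding iff
    by (rule ex1_PiE[where f = "case_sum (\<lambda>_. \<gamma> $ 3) (\<lambda>_. \<gamma> $ 2 - \<gamma> $ 3 * m)"]) (simp add: I)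
qed simp

lemma darboux_frame_conifold:
  assumes "x \<in> conifold_base"
  obtains U gt where "x \<in> U" "U \<subseteq> conifold_base" "open U"
    "darboux_frame resolved_conifold U gt (\<lambda>i t. lat_beta)"
proof -
  have beta: "flat_section conifold_base conifold_trivs U (\<lambda>t. lat_beta)" if "open U" "U \<subseteq> conifold_base" for U
    using that by (simp add: flat_section_def conifold_trivs_def lat_components locally_constant_on_const cong: if_cong)
  have frame: "darboux_frame resolved_conifold U (\<lambda>i. s) (\<lambda>i t. lat_beta)"
    if s: "flat_section conifold_base conifold_trivs U s"
      and m: "\<And>t. s t = lat_betav + m t *s lat_beta" for U s m
  proof -
    have "open U" "U \<subseteq> conifold_base" using s by (simp_all add: flat_section_def)
    then show ?thesis
      unfolding darboux_frame_def resolved_conifold_simps cdim_complex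
      using s beta quotient_basis_conifold by (simp add: m lat_components)
  qed
  show thesis
  proof (cases "x \<in> neg_imag_axis")
    case False
    show thesis
      by (rule that[OF _ _ _ frame[OF conifold_flat_betav, of "\<lambda>_. 0"]])
         (use assms False open_conifold_cut in auto)
  next
    case True
    then have "Im x < 0"
      using neg_imag_axis_base[OF assms] by simp
    then show thesis
      by (intro that[OF _ _ _ frame[OF conifold_flat_betav_continued, of "\<lambda>t. if Re t \<le> 0 then 0 else 1"]])
         (use assms open_conifold_lower in auto)
  qed
qed

text \<open>
  The monodromy adds to each argument a multiple of \<open>\<beta>\<close> proportional to its \<open>\<beta>\<^sup>\<or>\<close> component, and this
  shear has determinant one, so the symplectic pairing does not see it.
\<close>

lemma pairing_flat_locally_constant:
  fixes s s' :: "complex \<Rightarrow> int ^ 3"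
  assumes s: "flat_section conifold_base conifold_trivs U s"
    and s': "flat_section conifold_base conifold_trivs U s'"
  shows "locally_constant_on U (\<lambda>x. s x $ 3 * s' x $ 2 - s x $ 2 * s' x $ 3)"
  unfolding locally_constant_on_def constant_on_def
proof
  fix x assume x: "x \<in> U"
  obtain V where V: "open V" "x \<in> V"
    "\<And>y. y \<in> V \<Longrightarrow> s y = (if x \<in> neg_imag_axis \<and> 0 < Re y then s x + (s x $ 3) *s lat_beta else s x)"
    by (rule flat_section_germ[OF s x]) blast
  obtain V' where V': "open V'" "x \<in> V'"
    "\<And>y. y \<in> V' \<Longrightarrow> s' y = (if x \<in> neg_imag_axis \<and> 0 < Re y then s' x + (s' x $ 3) *s lat_beta else s' x)"
    by (rule flat_section_germ[OF s' x]) blast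
  have "s y $ 3 * s' y $ 2 - s y $ 2 * s' y $ 3 = s x $ 3 * s' x $ 2 - s x $ 2 * s' x $ 3" if "y \<in> U \<inter> (V \<inter> V')" for y
    using V(3)[of y] V'(3)[of y] that by (simp add: lat_components algebra_simps)
  then have "\<exists>c. \<forall>y\<in>U \<inter> (V \<inter> V'). s y $ 3 * s' y $ 2 - s y $ 2 * s' y $ 3 = c" by blast
  then show "\<exists>V. open V \<and> x \<in> V \<and> (\<exists>c. \<forall>y\<in>U \<inter> V. s y $ 3 * s' y $ 2 - s y $ 2 * s' y $ 3 = c)"
    using V(1,2) V'(1,2) by (intro exI[of _ "V \<inter> V'"]) (simp add: open_Int)
qed

lemma central_charge_setting_conifold: "central_charge_setting ((*) \<i>) resolved_conifold"
  unfolding central_charge_setting_def resolved_conifold_simps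
proof (intro conjI)
  show "complex_structure ((*) \<i>)"
    by (simp add: complex_structure_def linear_iff algebra_simps scaleR_conv_of_real)
  show "open conifold_base" by (rule open_conifold_base)
  show "local_system conifold_base conifold_trivs" by (rule local_system_conifold)
  have "quotient_basis (range (\<lambda>k. k *s lat_delta)) {0} {..<1::nat} (\<lambda>j. lat_delta)"
    unfolding quotient_basis_def
  proof (intro conjI ballI)
    show "lat_delta \<in> range (\<lambda>k. k *s lat_delta)" by (simp add: mem_range_delta lat_components)
    fix \<gamma> assume "\<gamma> \<in> range (\<lambda>k. k *s lat_delta)"
    then obtain k where k: "\<gamma> = k *s lat_delta" by blast
    have "\<gamma> - (\<Sum>i\<in>{..<1::nat}. c i *s lat_delta) \<in> {0} \<longleftrightarrow> (\<forall>i\<in>{..<1}. c i = k)" for c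
    proof -
      have "\<gamma> - (\<Sum>i\<in>{..<1::nat}. c i *s lat_delta) = (k - c 0) *s lat_delta"
        by (simp add: k lessThan_Suc vector_ssub_ldistrib vec_eq_iff algebra_simps)
      note e1 = this
      have "lat_delta $ 1 = 1" by (simp add: axis_def)
      then have e2: "m *s lat_delta = 0 \<longleftrightarrow> m = 0" for m
        by (metis mult.right_neutral vector_smult_component vector_smult_lzero zero_index)
      show ?thesis unfolding e1 singleton_iff e2 by auto
    qed
    then show "\<exists>!c. c \<in> {..<1::nat} \<rightarrow>\<^sub>E UNIV \<and> \<gamma> - (\<Sum>i\<in>{..<1}. c i *s lat_delta) \<in> {0}"
      by (rule ex1_PiE)
  qed
  moreover have "(\<lambda>x. conifold_charge x lat_delta) constant_on conifold_base"
    by (auto simp: constant_on_def conifold_charge_def lat_components)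
  ultimately show "\<exists>k f. (\<forall>j<(k::nat). flat_section conifold_base conifold_trivs conifold_base (f j) \<and>
               (\<lambda>x. conifold_charge x (f j x)) constant_on conifold_base) \<and>
            (\<forall>x\<in>conifold_base. quotient_basis (range (\<lambda>k. k *s lat_delta)) {0} {..<k} (\<lambda>j. f j x))"
    using conifold_flat_delta by (intro exI[of _ 1] exI[of _ "\<lambda>j t. lat_delta"]) simp
  show "\<forall>x\<in>conifold_base. 0 \<in> range (\<lambda>k. k *s lat_delta) \<and>
        (\<forall>\<gamma>\<in>range (\<lambda>k. k *s lat_delta). \<forall>\<gamma>'\<in>range (\<lambda>k. k *s lat_delta). \<gamma> - \<gamma>' \<in> range (\<lambda>k. k *s lat_delta))"
    unfolding mem_range_delta by (simp add: mem_range_delta)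
  have "Modules.additive (\<lambda>\<gamma>' :: int ^ 3. \<gamma> $ 3 * \<gamma>' $ 2 - \<gamma> $ 2 * \<gamma>' $ 3)" for \<gamma> :: "int ^ 3"
    by unfold_locales (simp add: distrib_left)
  moreover have "\<gamma> $ 3 * \<gamma>' $ 2 - \<gamma> $ 2 * \<gamma>' $ 3 = 0" if "\<gamma>' \<in> range (\<lambda>k. k *s lat_delta)"
    for \<gamma> \<gamma>' :: "int ^ 3"
    using that unfolding mem_range_delta by simp
  ultimately show "\<forall>x\<in>conifold_base. \<forall>\<gamma> :: int ^ 3. Modules.additive (\<lambda>\<gamma>' :: int ^ 3. \<gamma> $ 3 * \<gamma>' $ 2 - \<gamma> $ 2 * \<gamma>' $ 3) \<and>
        (\<forall>\<gamma>'. \<gamma>' $ 3 * \<gamma> $ 2 - \<gamma>' $ 2 * \<gamma> $ 3 = - (\<gamma> $ 3 * \<gamma>' $ 2 - \<gamma> $ 2 * \<gamma>' $ 3)) \<and>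
        (\<forall>\<gamma>'\<in>range (\<lambda>k. k *s lat_delta). \<gamma> $ 3 * \<gamma>' $ 2 - \<gamma> $ 2 * \<gamma>' $ 3 = 0)"
    by simp
  show "\<forall>U s s'. flat_section conifold_base conifold_trivs U s \<and> flat_section conifold_base conifold_trivs U s' \<longrightarrow>
        locally_constant_on U (\<lambda>x. s x $ 3 * s' x $ 2 - s x $ 2 * s' x $ 3)"
    using pairing_flat_locally_constant by blast
  show "\<forall>x\<in>conifold_base. \<exists>U gt g. x \<in> U \<and> U \<subseteq> conifold_base \<and> open U \<and> darboux_frame resolved_conifold U gt g"
  proof
    fix x assume "x \<in> conifold_base"
    then obtain U gt where "x \<in> U" "U \<subseteq> conifold_base" "open U" "darboux_frame resolved_conifold U gt (\<lambda>i t. lat_beta)"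
      by (rule darboux_frame_conifold)
    then show "\<exists>U gt g. x \<in> U \<and> U \<subseteq> conifold_base \<and> open U \<and> darboux_frame resolved_conifold U gt g" by blast
  qed
  show "\<forall>x\<in>conifold_base. Modules.additive (conifold_charge x)"
    by (simp add: Modules.additive_def conifold_charge_def algebra_simps)
  show "\<forall>U s. flat_section conifold_base conifold_trivs U s \<longrightarrow> J_holomorphic_on ((*) \<i>) (\<lambda>x. conifold_charge x (s x)) U"
    unfolding J_holomorphic_on_def
  proof (intro allI impI ballI)
    fix U s x assume "flat_section conifold_base conifold_trivs U s" "x \<in> U"
    from has_field_derivative_charge_flat[OF this]
    show "\<exists>D. ((\<lambda>x. conifold_charge x (s x)) has_derivative D) (at x) \<and> (\<forall>v. D (\<i> * v) = \<i> * D v)"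
      unfolding has_field_derivative_def by (intro exI conjI) (assumption, simp add: algebra_simps)
  qed
qed

section \<open>The special Kaehler form and metric\<close>

lemma flat_extension_has_derivative:
  assumes "x \<in> conifold_base"
  shows "((\<lambda>y. conifold_charge y (flat_extension conifold_base conifold_trivs x \<gamma> y))
    has_field_derivative of_int (\<gamma> $ 2) + of_int (\<gamma> $ 3) * tau x) (at x)"
proof -
  let ?P = "\<lambda>s. s x = \<gamma> \<and> (\<exists>U. x \<in> U \<and> flat_section conifold_base conifold_trivs U s)"
  let ?s = "flat_extension conifold_base conifold_trivs x \<gamma>"
  obtain U s where "x \<in> U" "flat_section conifold_base conifold_trivs U s" "s x = \<gamma>"
    using assms by (rule flat_section_exists)
  then have "?P s" by blast
  then have "?P (SOME s. ?P s)" by (rule someI[of ?P])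
  then have s: "?P ?s" by (simp only: flat_extension_def)
  then obtain U where "x \<in> U" "flat_section conifold_base conifold_trivs U ?s" by blast
  from has_field_derivative_charge_flat[OF this(2,1)] s show ?thesis by simp
qed

lemma dcharge_conifold:
  assumes "x \<in> conifold_base"
  shows "dcharge resolved_conifold conifold_charge x v \<gamma> = (of_int (\<gamma> $ 2) + of_int (\<gamma> $ 3) * tau x) * v"
    "dcharge resolved_conifold (\<lambda>y \<gamma>. cnj (conifold_charge y \<gamma>)) x v \<gamma>
      = cnj ((of_int (\<gamma> $ 2) + of_int (\<gamma> $ 3) * tau x) * v)"
proof -
  note d = flat_extension_has_derivative[OF assms, of \<gamma>, unfolded has_field_derivative_def]
  show "dcharge resolved_conifold conifold_charge x v \<gamma> = (of_int (\<gamma> $ 2) + of_int (\<gamma> $ 3) * tau x) * v"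
    unfolding dcharge_def resolved_conifold_simps frechet_derivative_at[OF d, symmetric] ..
  have "((\<lambda>y. cnj (conifold_charge y (flat_extension conifold_base conifold_trivs x \<gamma> y)))
     has_derivative (\<lambda>v. cnj ((of_int (\<gamma> $ 2) + of_int (\<gamma> $ 3) * tau x) * v))) (at x)"
    by (rule bounded_linear.has_derivative[OF bounded_linear_cnj d])
  note d' = frechet_derivative_at[OF this, symmetric]
  show "dcharge resolved_conifold (\<lambda>y \<gamma>. cnj (conifold_charge y \<gamma>)) x v \<gamma>
      = cnj ((of_int (\<gamma> $ 2) + of_int (\<gamma> $ 3) * tau x) * v)"
    unfolding dcharge_def resolved_conifold_simps d' ..
qed

text \<open>
  The covectors that vanish on \<open>\<Gamma>\<^sub>f\<close> are exactly those of the displayed form, and \<open>(\<beta>\<^sup>\<or>, \<beta>)\<close> is a Darboux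
  frame.
\<close>

lemma dual_pairing_conifold:
  fixes a b c d :: complex
  shows "dual_pairing (pairing resolved_conifold x)
      (\<lambda>\<gamma>. of_int (\<gamma> $ 2) * a + of_int (\<gamma> $ 3) * b) (\<lambda>\<gamma>. of_int (\<gamma> $ 2) * c + of_int (\<gamma> $ 3) * d)
     = b * c - a * d"
proof -
  define \<xi> where "\<xi> a b \<gamma> = of_int (\<gamma> $ 2) * a + of_int (\<gamma> $ 3) * b" for a b :: complex and \<gamma> :: "int ^ 3"
  have additive: "Modules.additive (\<xi> a b)" for a b
    by unfold_locales (simp add: \<xi>_def distrib_right)
  have null: "\<xi> a b \<phi> = 0" if "\<phi> \<in> range (\<lambda>k. k *s lat_delta)" for a b \<phi>
    using that unfolding mem_range_delta \<xi>_def by simp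
  have "dual_pairing (pairing resolved_conifold x) (\<xi> a b) (\<xi> c d)
     = (\<Sum>i<Suc 0. \<xi> a b lat_betav * \<xi> c d lat_beta - \<xi> a b lat_beta * \<xi> c d lat_betav)"
  proof (rule dual_pairing_darboux[where F = "range (\<lambda>k. k *s lat_delta)"
        and gt = "\<lambda>_. lat_betav" and g = "\<lambda>_. lat_beta"])
    show "quotient_basis UNIV (range (\<lambda>k. k *s lat_delta)) ({..<Suc 0} <+> {..<Suc 0})
        (case_sum (\<lambda>_. lat_betav) (\<lambda>_. lat_beta))"
      using quotient_basis_conifold[of 0] by simp
    show "Modules.additive (pairing resolved_conifold x \<gamma>)" for \<gamma>
      by unfold_locales (simp add: distrib_left)
    show "pairing resolved_conifold x \<gamma>' \<gamma> = - pairing resolved_conifold x \<gamma> \<gamma>'" for \<gamma> \<gamma>'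
      by simp
    show "pairing resolved_conifold x \<gamma> \<phi> = 0" if "\<phi> \<in> range (\<lambda>k. k *s lat_delta)" for \<gamma> \<phi>
      using that unfolding mem_range_delta by simp
  qed (use additive null in \<open>simp_all add: lat_components\<close>)
  then show ?thesis by (simp add: lat_components \<xi>_def[abs_def])
qed

lemma wedge_pairing_conifold:
  assumes x: "x \<in> conifold_base"
  shows "wedge_pairing resolved_conifold conifold_charge conifold_charge x u v = 0"
proof -
  have *: "dcharge resolved_conifold conifold_charge x v
      = (\<lambda>\<gamma>. of_int (\<gamma> $ 2) * v + of_int (\<gamma> $ 3) * (tau x * v))" for v
    by (simp add: fun_eq_iff dcharge_conifold[OF x] algebra_simps)
  show ?thesis unfolding wedge_pairing_def * dual_pairing_conifold by (simp add: algebra_simps)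
qed

text \<open>
  The two-form \<open>\<i> / 2 Im \<tau> dt \<and> d(cnj t)\<close>.
\<close>

lemma ASK_form_conifold:
  assumes x: "x \<in> conifold_base"
  shows "ASK_form resolved_conifold x u v = \<i> / 2 * of_real (Im (tau x)) * (u * cnj v - v * cnj u)"
proof -
  have 1: "dcharge resolved_conifold conifold_charge x v
      = (\<lambda>\<gamma>. of_int (\<gamma> $ 2) * v + of_int (\<gamma> $ 3) * (tau x * v))" for v
    by (simp add: fun_eq_iff dcharge_conifold[OF x] algebra_simps)
  have 2: "dcharge resolved_conifold (\<lambda>y \<gamma>. cnj (conifold_charge y \<gamma>)) x v
      = (\<lambda>\<gamma>. of_int (\<gamma> $ 2) * cnj v + of_int (\<gamma> $ 3) * cnj (tau x * v))" for v
    by (simp add: fun_eq_iff dcharge_conifold[OF x] algebra_simps)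
  have "ASK_form resolved_conifold x u v
      = 1/4 * ((tau x - cnj (tau x)) * (u * cnj v - v * cnj u))"
    unfolding ASK_form_def wedge_pairing_def resolved_conifold_simps 1 2 dual_pairing_conifold
    by (simp add: algebra_simps)
  then show ?thesis by (simp add: complex_diff_cnj)
qed

lemma ASK_metric_conifold:
  assumes x: "x \<in> conifold_base"
  shows "ASK_metric ((*) \<i>) resolved_conifold x u v = of_real (Im (tau x) * Re (u * cnj v))"
proof -
  have "u * cnj (\<i> * v) - \<i> * v * cnj u = - \<i> * (u * cnj v + cnj (u * cnj v))"
    by (simp add: algebra_simps)
  also have "u * cnj v + cnj (u * cnj v) = of_real (2 * Re (u * cnj v))" by (rule complex_add_cnj)
  finally have *: "u * cnj (\<i> * v) - \<i> * v * cnj u = - \<i> * of_real (2 * Re (u * cnj v))" .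
  have "\<i> / 2 * of_real a * (- \<i> * of_real (2 * b)) = of_real (a * b)" for a b
    by (simp add: complex_eq_iff)
  then show ?thesis unfolding ASK_metric_def ASK_form_conifold[OF x] * .
qed

text \<open>
  A complex-linear form on \<open>\<complex>\<close> is multiplication by its value at \<open>1\<close>, so any non-zero one spans.
\<close>

lemma cotangent_basis_complex:
  assumes d: "(f 0 has_field_derivative d) (at x)" "d \<noteq> 0"
  shows "cotangent_basis ((*) \<i>) (Suc 0) (\<lambda>i. frechet_derivative (f i) (at x))"
proof -
  have f: "frechet_derivative (f 0) (at x) = (*) d"
    using frechet_derivative_at[OF d(1)[unfolded has_field_derivative_def]] by simp
  have "\<exists>!c. c \<in> {..<Suc 0} \<rightarrow>\<^sub>E UNIV \<and> (\<forall>v. l v = (\<Sum>i<Suc 0. c i * frechet_derivative (f i) (at x) v))"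
    if l: "linear l" "\<And>v. l (\<i> * v) = \<i> * l v" for l :: "complex \<Rightarrow> complex"
  proof -
    have lv: "l v = l 1 * v" for v
    proof -
      have "v = Re v *\<^sub>R 1 + Im v *\<^sub>R (\<i> * 1)" by (simp add: complex_eq_iff)
      then have "l v = l (Re v *\<^sub>R 1 + Im v *\<^sub>R (\<i> * 1))" by (rule arg_cong)
      also have "\<dots> = Re v *\<^sub>R l 1 + Im v *\<^sub>R (\<i> * l 1)"
        unfolding linear_add[OF l(1)] linear_cmul[OF l(1)] l(2) ..
      also have "\<dots> = l 1 * (Re v + \<i> * Im v)" by (simp add: scaleR_conv_of_real algebra_simps)
      finally show ?thesis by (simp add: complex_eq[symmetric])
    qed
    have iff: "(\<forall>v. l v = (\<Sum>i<Suc 0. c i * frechet_derivative (f i) (at x) v)) \<longleftrightarrow> c 0 = l 1 / d" for c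
    proof
      assume "\<forall>v. l v = (\<Sum>i<Suc 0. c i * frechet_derivative (f i) (at x) v)"
      then have "l 1 = c 0 * d" by (simp add: f)
      then show "c 0 = l 1 / d" using d(2) by simp
    next
      assume "c 0 = l 1 / d"
      then have "(\<Sum>i<Suc 0. c i * frechet_derivative (f i) (at x) v) = l 1 * v" for v
        using d(2) by (simp add: f)
      then show "\<forall>v. l v = (\<Sum>i<Suc 0. c i * frechet_derivative (f i) (at x) v)"
        using lv by (intro allI) (rule trans[OF lv sym])
    qed
    show ?thesis unfolding iff by (rule ex1_PiE[where f = "\<lambda>_. l 1 / d"]) (simp add: lessThan_Suc)
  qed
  then show ?thesis unfolding cotangent_basis_def
    by (auto simp: f linear_iff algebra_simps)
qed

text \<open>
  The relation \<open>\<langle>\<gamma>, \<gamma>'\<rangle> = 1\<close> forces both members of the frame to have a component outside \<open>\<Gamma>\<^sub>f\<close>, and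
  a non-trivial integral combination of \<open>1\<close> and the non-real number \<open>\<tau>\<close> does not vanish.
\<close>

lemma cotangent_basis_darboux_conifold:
  assumes "darboux_frame resolved_conifold U gt g" "x \<in> U"
  shows "cotangent_basis ((*) \<i>) (cdim TYPE(complex))
             (\<lambda>i. frechet_derivative (\<lambda>y. charge resolved_conifold y (g i y)) (at x)) \<and>
           cotangent_basis ((*) \<i>) (cdim TYPE(complex))
             (\<lambda>i. frechet_derivative (\<lambda>y. charge resolved_conifold y (gt i y)) (at x))"
proof -
  from assms have flat: "flat_section conifold_base conifold_trivs U (gt 0)" "flat_section conifold_base conifold_trivs U (g 0)"
    and pair: "gt 0 x $ 3 * g 0 x $ 2 - gt 0 x $ 2 * g 0 x $ 3 = 1"
    unfolding darboux_frame_def cdim_complex resolved_conifold_simps by auto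
  have "x \<in> conifold_base" using flat assms(2) by (auto simp: flat_section_def)
  then have tau: "Im (tau x) \<noteq> 0" by (rule Im_tau_nonzero)
  have nz: "of_int m + of_int n * tau x \<noteq> 0" if "m \<noteq> 0 \<or> n \<noteq> 0" for m n :: int
  proof
    assume *: "of_int m + of_int n * tau x = 0"
    then have "Im (of_int m + of_int n * tau x) = 0" by simp
    then have "n = 0" using tau by simp
    with * that show False by simp
  qed
  have "g 0 x $ 2 \<noteq> 0 \<or> g 0 x $ 3 \<noteq> 0" "gt 0 x $ 2 \<noteq> 0 \<or> gt 0 x $ 3 \<noteq> 0"
    using pair by auto
  note nz = this[THEN nz]
  show ?thesis
    unfolding cdim_complex resolved_conifold_simps
    using cotangent_basis_complex[where f = "\<lambda>i y. conifold_charge y (g i y)", OF has_field_derivative_charge_flat[OF flat(2) assms(2)] nz(1)]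
      cotangent_basis_complex[where f = "\<lambda>i y. conifold_charge y (gt i y)", OF has_field_derivative_charge_flat[OF flat(1) assms(2)] nz(2)]
    by blast
qed

lemma open_conifold_plus: "open conifold_plus"
proof -
  have eq: "conifold_plus = conifold_base \<inter> {t. 1 < 2 * Re (q_exp t)}"
    by (auto simp: conifold_plus_def)
  show ?thesis
    unfolding eq by (intro open_Int open_conifold_base open_Collect_less continuous_intros)
qed

lemma open_conifold_minus: "open conifold_minus"
proof -
  have eq: "conifold_minus = conifold_base \<inter> {t. 2 * Re (q_exp t) < 1}"
    by (auto simp: conifold_minus_def)
  show ?thesis
    unfolding eq by (intro open_Int open_conifold_base open_Collect_less continuous_intros)
qed

text \<open>
  Stated with a factor \<open>r\<close> to cover both the metric on \<open>M\<^sub>+\<close> and the negative of the metric on \<open>M\<^sub>-\<close>.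
\<close>

lemma positive_definite_conformal:
  assumes U: "open U" "U \<subseteq> conifold_base" and r: "\<And>x. x \<in> U \<Longrightarrow> 0 < r * Im (tau x)"
    and g: "\<And>x u v. x \<in> U \<Longrightarrow> g x u v = of_real (r * Im (tau x) * Re (u * cnj v))"
  shows "positive_definite_metric_on U g"
  unfolding positive_definite_metric_on_def
proof (intro conjI allI ballI)
  fix u v k
  have "Ck_on k U (\<lambda>x. of_real (Im (tau x) * (r * Re (u * cnj v))))" by (rule Ck_on_Im_tau[OF U])
  then show "Ck_on k U (\<lambda>x. g x u v)"
    using Ck_on_cong[OF U(1), of "\<lambda>x. g x u v" "\<lambda>x. of_real (Im (tau x) * (r * Re (u * cnj v)))" k] g
    by (simp add: mult_ac)
next
  fix x assume x: "x \<in> U"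
  show "bilinear (g x)"
    unfolding bilinear_def linear_iff g[OF x] by (simp add: algebra_simps scaleR_conv_of_real)
  show "g x u v \<in> \<real>" for u v by (simp add: g[OF x])
  show "g x u v = g x v u" for u v by (simp add: g[OF x] algebra_simps)
  show "u \<noteq> 0 \<longrightarrow> 0 < Re (g x u u)" for u
  proof
    assume "u \<noteq> 0"
    then have "0 < Re (u * cnj u)" by (simp add: complex_mult_cnj complex_eq_iff sum_power2_gt_zero_iff)
    then show "0 < Re (g x u u)" using r[OF x] unfolding g[OF x] Re_complex_of_real by (rule mult_pos_pos[rotated])
  qed
qed

theorem proposition7:
  shows "central_charge_ASK_geometry ((*) \<i>) resolved_conifold \<and>
    positive_definite_metric_on conifold_plus (ASK_metric ((*) \<i>) resolved_conifold) \<and>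
    negative_definite_metric_on conifold_minus (ASK_metric ((*) \<i>) resolved_conifold)"
proof (intro conjI)
  have "u = 0" if x: "x \<in> conifold_base" and 0: "\<forall>v. ASK_form resolved_conifold x u v = 0" for x u
  proof -
    have "ASK_metric ((*) \<i>) resolved_conifold x u u = 0" using 0 by (simp add: ASK_metric_def)
    then have "Im (tau x) * Re (u * cnj u) = 0" unfolding ASK_metric_conifold[OF x] by (simp only: of_real_eq_0_iff)
    then have "Re (u * cnj u) = 0" using Im_tau_nonzero[OF x] by simp
    then show "u = 0" by (simp add: complex_mult_cnj complex_eq_iff sum_power2_eq_zero_iff)
  qed
  then show "central_charge_ASK_geometry ((*) \<i>) resolved_conifold"
    unfolding central_charge_ASK_geometry_def
    using central_charge_setting_conifold cotangent_basis_darboux_conifold wedge_pairing_conifold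
    unfolding resolved_conifold_simps by blast
  show "positive_definite_metric_on conifold_plus (ASK_metric ((*) \<i>) resolved_conifold)"
  proof (rule positive_definite_conformal[where r = 1])
    show sub: "conifold_plus \<subseteq> conifold_base" by (auto simp: conifold_plus_def)
    show "ASK_metric ((*) \<i>) resolved_conifold x u v = of_real (1 * Im (tau x) * Re (u * cnj v))"
      if "x \<in> conifold_plus" for x u v
      unfolding mult_1 by (rule ASK_metric_conifold) (use sub that in blast)
  qed (simp_all add: open_conifold_plus Im_tau_pos)
  show "negative_definite_metric_on conifold_minus (ASK_metric ((*) \<i>) resolved_conifold)"
    unfolding negative_definite_metric_on_def
  proof (rule positive_definite_conformal[where r = "-1"])
    show sub: "conifold_minus \<subseteq> conifold_base" by (auto simp: conifold_minus_def)
    show "- ASK_metric ((*) \<i>) resolved_conifold x u v = of_real (- 1 * Im (tau x) * Re (u * cnj v))"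
      if "x \<in> conifold_minus" for x u v
      using ASK_metric_conifold[of x u v] sub that by auto
  qed (simp_all add: open_conifold_minus Im_tau_neg)
qed

end
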